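(* Let $1<p<\infty$ and let $\rho_0,\rho_1,\mu_0,\mu_1$ be discrete (finitely supported) probability measures on $\mathbb{R}^d$. Let $\gamma_0\in\Pi(\rho_0,\mu_0)$ and $\gamma_1\in\Pi(\rho_1,\mu_1)$ be optimal plans for the cost $\|x-y\|^p$. Let $(\rho_t)_{t\in[0,1]}$ and $(\mu_t)_{t\in[0,1]}$ be $W_p$ geodesics connecting $\rho_0$ to $\rho_1$ and $\mu_0$ to $\mu_1$. Assume that for each $t\in[0,1]$ the optimal transport problem with cost $\|x-y\|^p$ over $\Pi(\rho_t,\mu_t)$ has a unique solution. Then $$W_p^p(\gamma_0,\gamma_1)\le C_p\left(W_p^p(\rho_0,\rho_1)+W_p^p(\mu_0,\mu_1)\right),\qquad C_p=\max\left(1,2^{\frac p2-1}\right).$$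
   Context: $\Pi(\rho,\mu)$ is the set of couplings of $\rho$ and $\mu$; $W_p$ is the $p$-Wasserstein distance for the Euclidean norm, on $\mathbb{R}^d$ for the marginals and on the product $\mathbb{R}^d\times\mathbb{R}^d=\mathbb{R}^{2d}$ (with its Euclidean norm) for the plans. A $W_p$ geodesic is a constant-speed geodesic in the $W_p$ metric; for $p>1$ these are exactly the curves $\rho_t=((x_0,x_1)\mapsto(1-t)x_0+tx_1)_\#\pi$ with $\pi\in\Pi(\rho_0,\rho_1)$ optimal for the cost $\|x-y\|^p$. *)

theory Defs
  imports "HOL-Probability.Probability"
begin

definition borel_prob :: "'a::topological_space measure \<Rightarrow> bool" where
  "borel_prob \<mu> \<longleftrightarrow> prob_space \<mu> \<and> sets \<mu> = sets borel"

definition finitely_supported :: "'a::topological_space measure \<Rightarrow> bool" where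
  "finitely_supported \<mu> \<longleftrightarrow> (\<exists>S. finite S \<and> (AE x in \<mu>. x \<in> S))"

text \<open>The space of Borel probability measures with finite \<open>p\<close>-th moment, on which the
  \<open>p\<close>-Wasserstein distance is a metric.\<close>

definition wasserstein_space :: "real \<Rightarrow> 'a::euclidean_space measure set" where
  "wasserstein_space p = {\<mu>. borel_prob \<mu> \<and> (\<integral>\<^sup>+x. ennreal (norm x powr p) \<partial>\<mu>) < \<infinity>}"

definition couplings ::
  "'a::topological_space measure \<Rightarrow> 'b::topological_space measure \<Rightarrow> ('a \<times> 'b) measure set" where
  "couplings \<rho> \<mu> = {\<pi>. borel_prob \<pi> \<and> distr \<pi> borel fst = \<rho> \<and> distr \<pi> borel snd = \<mu>}"

definition transport_cost :: "real \<Rightarrow> ('a::euclidean_space \<times> 'a) measure \<Rightarrow> ennreal" where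
  "transport_cost p \<pi> = (\<integral>\<^sup>+z. ennreal (norm (fst z - snd z) powr p) \<partial>\<pi>)"

definition optimal_plan ::
  "real \<Rightarrow> 'a::euclidean_space measure \<Rightarrow> 'a measure \<Rightarrow> ('a \<times> 'a) measure \<Rightarrow> bool" where
  "optimal_plan p \<rho> \<mu> \<gamma> \<longleftrightarrow>
     \<gamma> \<in> couplings \<rho> \<mu> \<and> (\<forall>\<pi>\<in>couplings \<rho> \<mu>. transport_cost p \<gamma> \<le> transport_cost p \<pi>)"

text \<open>The value is meaningful for measures in \<^const>\<open>wasserstein_space\<close>, where the infimum is
  finite; elsewhere an infinite infimum is sent to \<open>0\<close> by \<^const>\<open>enn2real\<close>.
  For plans, the type \<open>'a\<close> is itself a product type, whose library norm
  \<open>sqrt ((norm x)\<^sup>2 + (norm y)\<^sup>2)\<close> is the Euclidean one.\<close>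

definition wasserstein :: "real \<Rightarrow> 'a::euclidean_space measure \<Rightarrow> 'a measure \<Rightarrow> real" where
  "wasserstein p \<rho> \<mu> = enn2real (INF \<pi>\<in>couplings \<rho> \<mu>. transport_cost p \<pi>) powr (1 / p)"

text \<open>Constant-speed geodesics parametrised by \<open>[0,1]\<close>; values of the curve at other
  times are irrelevant.\<close>

definition wasserstein_geodesic :: "real \<Rightarrow> (real \<Rightarrow> 'a::euclidean_space measure) \<Rightarrow> bool" where
  "wasserstein_geodesic p \<rho> \<longleftrightarrow>
     (\<forall>t\<in>{0..1}. \<rho> t \<in> wasserstein_space p) \<and>
     (\<forall>s\<in>{0..1}. \<forall>t\<in>{0..1}.
        wasserstein p (\<rho> s) (\<rho> t) = \<bar>s - t\<bar> * wasserstein p (\<rho> 0) (\<rho> 1))"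

end

theory Submission imports Defs
begin

text \<open>Strict convexity of \<open>norm _ powr p\<close> makes the equality case of the triangle inequality rigid:
  a plan through an intermediate measure of a geodesic is carried by segments, crossed at constant
  proportion. Hence both geodesics are displacement interpolations of finitely supported plans
  \<open>\<alpha>\<close> and \<open>\<beta>\<close>, and for \<open>0 < t < 1\<close> distinct particles sit at distinct points. At such times
  plans between \<open>\<rho> t\<close> and \<open>\<mu> t\<close> are the same thing as couplings \<open>w\<close> of \<open>\<alpha>\<close> and \<open>\<beta>\<close>: only the
  linear cost depends on \<open>t\<close>, and continuously so. A unique minimiser over this polytope is one of
  finitely many, so by connectedness it does not depend on \<open>t\<close>, and by continuity it is still
  optimal at \<open>t = 0, 1\<close>. By uniqueness its images there are \<open>\<gamma>\<^sub>0\<close> and \<open>\<gamma>\<^sub>1\<close>, and moving each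
  pair of particles along \<open>w\<close> couples them at the claimed cost.\<close>

subsection \<open>Convexity inequalities\<close>

text \<open>A geodesic is given only through its distances, so nothing is known in advance about the
  intermediate measures: \<open>\<rho> t\<close> could a priori be diffuse. The triangle inequality
  is therefore proved with a remainder that charges every point outside a finite set of candidates,
  and only after finite support is established do plans become finite tables of weights. Rigidity at
  one time yields an interpolating plan that could still depend on that time; comparing two times
  removes this dependence. Particles rather than positions are coupled because positions may merge
  at \<open>t = 0\<close> and \<open>t = 1\<close>. There \<open>w\<close> need not be the only
  minimiser, and uniqueness is applied to its image only. The constant compares the Euclidean norm
  of a pair with the sum of \<open>p\<close>-th powers: (a^2 + b^2)^(p/2) against a^p + b^p, by
  subadditivity of the power for \<open>p <= 2\<close> and by its convexity for
  \<open>p > 2\<close>.\<close>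

lemma powr_bernoulli_strict:
  fixes s p :: real
  assumes "1 < p" "0 \<le> s" "s \<noteq> 1"
  shows "1 + p * (s - 1) < s powr p"
proof (cases "s = 0")
  case False
  with assms have s: "s > 0" by simp
  have "ln (1 / s) < 1 / s - 1"
    using s assms(3) ln_le_minus_one[of "1 / s"] ln_eq_minus_one[of "1 / s"] by fastforce
  then have ln: "1 - 1 / s < ln s"
    using s by (simp add: ln_div)
  \<comment> \<open>Factoring out \<open>s\<close> leaves the exponent \<open>p - 1\<close>, for
    which \<open>exp u >= 1 + u\<close> at \<open>u = (p - 1) * ln s\<close> suffices. Strictness
    comes from the logarithm inequality \<open>ln\<close>.\<close>
  have "1 + p * (s - 1) = s * (1 + (p - 1) * (1 - 1 / s))"
    using s by (simp add: field_simps)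
  also have "\<dots> < s * (1 + (p - 1) * ln s)"
    using ln s assms(1) by simp
  also have "\<dots> \<le> s * exp ((p - 1) * ln s)"
    using s exp_ge_add_one_self[of "(p - 1) * ln s"] by (intro mult_left_mono) auto
  also have "\<dots> = s powr 1 * s powr (p - 1)"
    using s by (simp add: powr_def)
  also have "\<dots> = s powr p"
    by (subst powr_add[symmetric]) simp
  finally show ?thesis .
qed (use assms in auto)

text \<open>Homogeneity reduces the tangent at \<open>m\<close> to the Bernoulli inequality at
  \<open>a / m\<close>. No derivative is taken, so \<open>a = 0\<close> is covered.\<close>

lemma powr_tangent_strict:
  fixes a m p :: real
  assumes "1 < p" "0 \<le> a" "0 < m" "a \<noteq> m"
  shows "m powr p + p * m powr (p - 1) * (a - m) < a powr p"
proof -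
  have *: "m powr p = m powr (p - 1) * m"
    using assms(3) by (simp add: powr_mult_base mult.commute)
  have "m powr p + p * m powr (p - 1) * (a - m) = m powr p * (1 + p * (a / m - 1))"
    unfolding * using assms(3) by (simp add: field_simps)
  also have "\<dots> < m powr p * (a / m) powr p"
    using assms by (intro mult_strict_left_mono powr_bernoulli_strict) auto
  also have "\<dots> = a powr p"
    using assms by (simp add: powr_mult[symmetric])
  finally show ?thesis .
qed

text \<open>Both values are compared with the tangent at the weighted mean \<open>m\<close>; the
  slope terms cancel in the weighted sum.\<close>

lemma powr_strict_convex:
  fixes a b t p :: real
  assumes "1 < p" "0 \<le> a" "0 \<le> b" "0 < t" "t < 1" "a \<noteq> b"
  shows "(t * a + (1 - t) * b) powr p < t * a powr p + (1 - t) * b powr p"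
proof -
  define m where "m = t * a + (1 - t) * b"
  have "0 < a \<or> 0 < b"
    using assms by linarith
  then have m: "0 < m"
    unfolding m_def using assms
    by (metis add_nonneg_pos add_pos_nonneg diff_gt_0_iff_gt less_imp_le mult_nonneg_nonneg mult_pos_pos)
  have "a - m = (1 - t) * (a - b)" "b - m = t * (b - a)"
    by (simp_all add: m_def algebra_simps)
  then have ne: "a \<noteq> m" "b \<noteq> m"
    using assms by (metis diff_self eq_iff_diff_eq_0 less_irrefl mult_eq_0_iff)+
  have "t * (m powr p + p * m powr (p - 1) * (a - m)) < t * a powr p"
       "(1 - t) * (m powr p + p * m powr (p - 1) * (b - m)) < (1 - t) * b powr p"
    using powr_tangent_strict[OF assms(1,2) m ne(1)] powr_tangent_strict[OF assms(1,3) m ne(2)] assms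
    by simp_all
  moreover have "t * (m powr p + p * m powr (p - 1) * (a - m))
      + (1 - t) * (m powr p + p * m powr (p - 1) * (b - m))
      = m powr p + p * m powr (p - 1) * (t * a + (1 - t) * b - m)"
    by (simp add: algebra_simps)
  ultimately show ?thesis
    unfolding m_def by simp
qed

text \<open>Triangle inequality followed by scalar convexity. In the equality case strict scalar
  convexity forces equal norms, and the inner product then excludes different directions.\<close>

lemma norm_powr_convex:
  fixes v w :: "'a::real_inner"
  assumes "1 < p" "0 < t" "t < 1"
  shows "norm (t *\<^sub>R v + (1 - t) *\<^sub>R w) powr p \<le> t * norm v powr p + (1 - t) * norm w powr p"
    and "norm (t *\<^sub>R v + (1 - t) *\<^sub>R w) powr p = t * norm v powr p + (1 - t) * norm w powr p \<Longrightarrow> v = w"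
proof -
  let ?m = "t * norm v + (1 - t) * norm w"
  have tri: "norm (t *\<^sub>R v + (1 - t) *\<^sub>R w) \<le> ?m"
    using norm_triangle_ineq[of "t *\<^sub>R v" "(1 - t) *\<^sub>R w"] assms by simp
  then have le1: "norm (t *\<^sub>R v + (1 - t) *\<^sub>R w) powr p \<le> ?m powr p"
    using assms by (intro powr_mono2) auto
  have m: "norm v \<noteq> norm w \<Longrightarrow> ?m powr p < t * norm v powr p + (1 - t) * norm w powr p"
    using assms by (intro powr_strict_convex) auto
  have m': "norm v = norm w \<Longrightarrow> ?m powr p = t * norm v powr p + (1 - t) * norm w powr p"
    by (simp add: algebra_simps)
  show "norm (t *\<^sub>R v + (1 - t) *\<^sub>R w) powr p \<le> t * norm v powr p + (1 - t) * norm w powr p"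
    using le1 m m' by linarith
  assume eq: "norm (t *\<^sub>R v + (1 - t) *\<^sub>R w) powr p = t * norm v powr p + (1 - t) * norm w powr p"
  then have vw: "norm v = norm w"
    using le1 m by linarith
  then have mv: "?m = norm v"
    by (simp add: algebra_simps)
  have "norm (t *\<^sub>R v + (1 - t) *\<^sub>R w) = norm v"
  proof (rule ccontr)
    assume "norm (t *\<^sub>R v + (1 - t) *\<^sub>R w) \<noteq> norm v"
    then have "norm (t *\<^sub>R v + (1 - t) *\<^sub>R w) powr p < norm v powr p"
      using tri mv assms by (intro powr_less_mono2) auto
    then show False
      using eq m' vw mv by simp
  qed
  then have "(t *\<^sub>R v + (1 - t) *\<^sub>R w) \<bullet> (t *\<^sub>R v + (1 - t) *\<^sub>R w) = v \<bullet> v"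
    by (simp add: norm_eq)
  moreover have ww: "w \<bullet> w = v \<bullet> v"
    using vw by (simp add: norm_eq)
  \<comment> \<open>Expansion of the squared norm of the combination, with
    \<open>w \<bullet> w\<close> replaced by \<open>v \<bullet> v\<close>.\<close>
  ultimately have "t * (1 - t) * (2 * (v \<bullet> w) - 2 * (v \<bullet> v)) = 0"
    by (simp add: inner_simps inner_commute algebra_simps)
  then have "v \<bullet> w = v \<bullet> v"
    using assms by simp
  then have "(v - w) \<bullet> (v - w) = 0"
    using ww by (simp add: inner_simps inner_commute)
  then show "v = w"
    by simp
qed

text \<open>After division by \<open>a + b\<close> both terms lie in [0,1], where lowering the
  exponent from 1 to \<open>q\<close> can only increase them.\<close>

lemma add_powr_le_powr_add:
  fixes a b q :: real
  assumes "0 \<le> a" "0 \<le> b" "0 < q" "q \<le> 1"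
  shows "(a + b) powr q \<le> a powr q + b powr q"
proof (cases "a + b = 0")
  case False
  with assms have s: "0 < a + b" by linarith
  have *: "x / (a + b) \<le> (x / (a + b)) powr q" if "0 \<le> x" "x \<le> a + b" for x
    using powr_mono'[of q 1 "x / (a + b)"] that assms s by auto
  have "1 = a / (a + b) + b / (a + b)"
    using s by (simp add: add_divide_distrib[symmetric])
  also have "\<dots> \<le> (a / (a + b)) powr q + (b / (a + b)) powr q"
    using * assms by (intro add_mono) auto
  also have "\<dots> = (a powr q + b powr q) / (a + b) powr q"
    using assms by (simp add: powr_divide add_divide_distrib)
  finally show ?thesis
    using s by (simp add: pos_le_divide_eq)
qed (use assms in auto)

text \<open>The origin of the constant. The squared norms \<open>a\<close>, \<open>b\<close> are
  raised to the power \<open>p / 2\<close>: for \<open>p <= 2\<close> this power is subadditive, and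
  for \<open>p > 2\<close> midpoint convexity costs the factor
  \<open>2 powr (p / 2 - 1)\<close>.\<close>

lemma norm_Pair_powr_le:
  fixes x :: "'a::real_normed_vector" and y :: "'b::real_normed_vector"
  assumes "1 < p"
  shows "norm (x, y) powr p \<le> max 1 (2 powr (p / 2 - 1)) * (norm x powr p + norm y powr p)"
proof -
  define a b where "a = (norm x)\<^sup>2" and "b = (norm y)\<^sup>2"
  have ab: "0 \<le> a" "0 \<le> b" by (auto simp: a_def b_def)
  have sq: "(u\<^sup>2) powr (p / 2) = u powr p" if "0 \<le> u" for u :: real
    using that powr_powr[of u 2 "p / 2"] by (cases "u = 0") (simp_all add: powr_numeral)
  have "norm (x, y) powr p = (a + b) powr (p / 2)"
    unfolding norm_Pair a_def b_def by (subst sq[symmetric]) auto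
  also have "\<dots> \<le> max 1 (2 powr (p / 2 - 1)) * (a powr (p / 2) + b powr (p / 2))"
  proof (cases "p \<le> 2")
    case True
    then have "(a + b) powr (p / 2) \<le> 1 * (a powr (p / 2) + b powr (p / 2))"
      using add_powr_le_powr_add[OF ab, of "p / 2"] assms by simp
    also have "\<dots> \<le> max 1 (2 powr (p / 2 - 1)) * (a powr (p / 2) + b powr (p / 2))"
      by (intro mult_right_mono) auto
    finally show ?thesis .
  next
    case False
    then have q: "1 < p / 2" by simp
    have "(a / 2 + b / 2) powr (p / 2) \<le> a powr (p / 2) / 2 + b powr (p / 2) / 2"
      using powr_strict_convex[OF q ab, of "1/2"] by (cases "a = b") auto
    moreover have "(a / 2 + b / 2) powr (p / 2) = (a + b) powr (p / 2) / 2 powr (p / 2)"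
      using ab by (simp add: add_divide_distrib[symmetric] powr_divide)
    ultimately have "(a + b) powr (p / 2) / 2 powr (p / 2) \<le> (a powr (p / 2) + b powr (p / 2)) / 2"
      by (simp only: add_divide_distrib)
    then have "(a + b) powr (p / 2) \<le> 2 powr (p / 2) / 2 * (a powr (p / 2) + b powr (p / 2))"
      by (subst (asm) pos_divide_le_eq) (simp_all add: mult_ac)
    also have "2 powr (p / 2) / 2 = (2 powr (p / 2 - 1) :: real)"
      by (simp add: powr_diff)
    also have "\<dots> * (a powr (p / 2) + b powr (p / 2))
        \<le> max 1 (2 powr (p / 2 - 1)) * (a powr (p / 2) + b powr (p / 2))"
      by (intro mult_right_mono) auto
    finally show ?thesis .
  qed
  finally show ?thesis
    by (simp add: a_def b_def sq)
qed

subsection \<open>Finitely supported measures as probability mass functions\<close>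

lemma obtain_pmf_of_weights:
  fixes f :: "'a \<Rightarrow> real"
  assumes "finite S" "\<And>x. x \<in> S \<Longrightarrow> 0 \<le> f x" "sum f S = 1"
  obtains u where "\<And>x. pmf u x = (if x \<in> S then f x else 0)" "set_pmf u \<subseteq> S"
proof -
  define g where "g = (\<lambda>x. if x \<in> S then f x else 0)"
  have g0: "\<forall>x. 0 \<le> g x" using assms by (auto simp: g_def)
  have "(\<integral>\<^sup>+x. ennreal (g x) \<partial>count_space UNIV) = (\<Sum>x\<in>S. ennreal (g x))"
    using assms(1) by (intro nn_integral_count_space') (auto simp: g_def)
  also have "\<dots> = ennreal (\<Sum>x\<in>S. f x)"
    using assms by (simp add: g_def)
  finally have g1: "(\<integral>\<^sup>+x. ennreal (g x) \<partial>count_space UNIV) = 1"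
    using assms by simp
  have *: "pmf (embed_pmf g) x = (if x \<in> S then f x else 0)" for x
    using g0 g1 by (subst pmf_embed_pmf) (auto simp: g_def)
  show ?thesis
    by (rule that[of "embed_pmf g"]) (auto simp: * set_pmf_eq)
qed

text \<open>Gluing along \<open>f x = g y\<close>, conditionally independently, so that the support is as large
  as possible.\<close>

lemma pmf_glue:
  assumes "map_pmf f A = map_pmf g B"
  obtains C where "map_pmf fst C = A" "map_pmf snd C = B"
    "set_pmf C = {(a, b). a \<in> set_pmf A \<and> b \<in> set_pmf B \<and> f a = g b}"
proof -
  define K where "K = (\<lambda>a. cond_pmf B {b. f a = g b})"
  define C where "C = bind_pmf A (\<lambda>a. map_pmf (Pair a) (K a))"
  have im: "f ` set_pmf A = g ` set_pmf B"
    using arg_cong[OF assms, of set_pmf] by simp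
  have ne: "set_pmf B \<inter> {b. f a = g b} \<noteq> {}" if "a \<in> set_pmf A" for a
    using im that by (auto simp: image_iff set_eq_iff)
  have ne': "set_pmf A \<inter> {a. f a = g b} \<noteq> {}" if "b \<in> set_pmf B" for b
    using im that by (auto simp: image_iff set_eq_iff) metis
  \<comment> \<open>Fibres of \<open>f\<close> and \<open>g\<close> over a common value have equal
    mass. This is the condition for the conditional laws \<open>K a\<close>, averaged over
    \<open>A\<close>, to give back \<open>B\<close>.\<close>
  have "measure B {y. f a = g y} = measure A {x. f x = g b}" if "f a = g b" for a b
  proof -
    have "measure B {y. f a = g y} = measure (map_pmf g B) {f a}"
      by (simp add: vimage_def eq_commute)
    also have "\<dots> = measure A {x. f x = g b}"
      unfolding assms[symmetric] by (simp add: vimage_def that)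
    finally show ?thesis .
  qed
  then have K: "bind_pmf A K = B"
    unfolding K_def using ne ne' by (intro bind_cond_pmf_cancel) auto
  have "map_pmf fst C = A"
    by (simp add: C_def map_bind_pmf map_pmf_comp map_pmf_const bind_return_pmf')
  moreover have "map_pmf snd C = B"
    by (simp add: C_def map_bind_pmf map_pmf_comp K)
  moreover have "set_pmf C = {(a, b). a \<in> set_pmf A \<and> b \<in> set_pmf B \<and> f a = g b}"
    using ne by (auto simp: C_def K_def)
  ultimately show ?thesis ..
qed

lemma map_pmf_inj_on_eq:
  assumes "inj_on f S" "set_pmf A \<subseteq> S" "set_pmf B \<subseteq> S" "map_pmf f A = map_pmf f B"
  shows "A = B"
proof -
  have "map_pmf (inv_into S f) (map_pmf f C) = C" if "set_pmf C \<subseteq> S" for C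
    unfolding map_pmf_comp using that assms(1)
    by (intro map_pmf_idI) (auto intro!: inv_into_f_f)
  then show ?thesis
    using assms by metis
qed

text \<open>The underlying measure of a pmf lives on all subsets. Pushing it forward by
  \<open>id\<close> restricts it to Borel sets, as \<open>borel_prob\<close> demands.\<close>

definition borel_pmf :: "'a::topological_space pmf \<Rightarrow> 'a measure" where
  "borel_pmf q = distr (measure_pmf q) borel id"

lemma sets_borel_pmf[simp]: "sets (borel_pmf q) = sets borel"
  by (simp add: borel_pmf_def)

lemma borel_prob_borel_pmf[simp]: "borel_prob (borel_pmf q)"
  by (simp add: borel_prob_def borel_pmf_def measure_pmf.prob_space_distr)

lemma emeasure_borel_pmf:
  "A \<in> sets borel \<Longrightarrow> emeasure (borel_pmf q) A = emeasure (measure_pmf q) A"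
  by (simp add: borel_pmf_def emeasure_distr)

lemma borel_pmf_eq_iff[simp]:
  fixes q r :: "'a::t1_space pmf"
  shows "borel_pmf q = borel_pmf r \<longleftrightarrow> q = r"
proof
  assume *: "borel_pmf q = borel_pmf r"
  have "ennreal (pmf q x) = ennreal (pmf r x)" for x
    using arg_cong[OF *, of "\<lambda>M. emeasure M {x}"]
    by (simp add: emeasure_borel_pmf emeasure_pmf_single)
  then show "q = r"
    by (intro pmf_eqI) simp
qed simp

lemma nn_integral_borel_pmf:
  "f \<in> borel_measurable borel \<Longrightarrow> (\<integral>\<^sup>+x. f x \<partial>borel_pmf q) = (\<integral>\<^sup>+x. f x \<partial>measure_pmf q)"
  by (simp add: borel_pmf_def nn_integral_distr)

lemma distr_borel_pmf:
  assumes "f \<in> borel_measurable borel"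
  shows "distr (borel_pmf q) borel f = borel_pmf (map_pmf f q)"
proof (rule measure_eqI)
  fix A assume "A \<in> sets (distr (borel_pmf q) borel f)"
  then have A: "A \<in> sets borel" by simp
  have "f -` A \<in> sets borel"
    using assms A by (metis measurable_sets_borel)
  then show "emeasure (distr (borel_pmf q) borel f) A = emeasure (borel_pmf (map_pmf f q)) A"
    using A assms by (subst emeasure_distr) (auto simp: emeasure_borel_pmf borel_pmf_def emeasure_distr)
qed simp

text \<open>Finite sets are closed, hence Borel, so \<open>M\<close> is determined by its masses at
  the points of \<open>S\<close>; these masses serve as weights.\<close>

lemma borel_pmf_finitely_supported:
  fixes M :: "'a::t1_space measure"
  assumes "borel_prob M" "finite S" "AE x in M. x \<in> S"
  obtains q where "M = borel_pmf q" "set_pmf q \<subseteq> S"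
proof -
  interpret prob_space M using assms by (simp add: borel_prob_def)
  have sets[simp]: "sets M = sets borel" using assms by (simp add: borel_prob_def)
  have sp[simp]: "space M = UNIV" using sets_eq_imp_space_eq[OF sets] by simp
  have fin: "T \<in> sets borel" if "finite T" for T :: "'a set"
    using that by (simp add: finite_imp_closed borel_closed)
  have "(\<Sum>x\<in>S. measure M {x}) = measure M S"
    using assms(2) by (intro finite_measure_eq_sum_singleton[symmetric]) (auto intro: fin)
  also have "\<dots> = 1"
    using assms by (intro prob_eq_1[THEN iffD2]) (auto intro: fin)
  finally obtain q where q: "\<And>x. pmf q x = (if x \<in> S then measure M {x} else 0)" "set_pmf q \<subseteq> S"
    using obtain_pmf_of_weights[of S "\<lambda>x. measure M {x}"] assms(2) by auto
  have "M = borel_pmf q"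
  proof (rule measure_eqI)
    fix A assume "A \<in> sets M"
    then have A: "A \<in> sets borel" by simp
    have fS: "finite (A \<inter> S)" using assms(2) by simp
    have "emeasure M A = emeasure M (A \<inter> S)"
      using assms A by (intro emeasure_eq_AE) (auto intro: fin)
    also have "\<dots> = (\<Sum>x\<in>A \<inter> S. emeasure M {x})"
      using fS by (intro emeasure_eq_sum_singleton) (auto intro: fin)
    also have "\<dots> = (\<Sum>x\<in>A \<inter> S. ennreal (pmf q x))"
      by (intro sum.cong) (auto simp: q emeasure_eq_measure)
    also have "\<dots> = emeasure (measure_pmf q) (A \<inter> S)"
      using fS by (simp add: emeasure_measure_pmf_finite)
    also have "\<dots> = emeasure (measure_pmf q) A"
      using q(2) by (intro emeasure_eq_AE) (auto simp: AE_measure_pmf_iff)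
    finally show "emeasure M A = emeasure (borel_pmf q) A"
      using A by (simp add: emeasure_borel_pmf)
  qed simp
  then show ?thesis using q(2) that by blast
qed

lemma AE_borel_pmf_finite:
  fixes q :: "'a::t1_space pmf"
  assumes "finite (set_pmf q)"
  shows "AE x in borel_pmf q. x \<in> set_pmf q"
proof -
  have "{x. x \<in> set_pmf q} \<in> sets borel"
    using assms by (simp add: finite_imp_closed borel_closed)
  then show ?thesis
    unfolding borel_pmf_def by (subst AE_distr_iff) (auto simp: AE_measure_pmf_iff)
qed

lemma fst_snd_borel_measurable[measurable]:
  "fst \<in> borel_measurable (borel :: ('a::topological_space \<times> 'b::topological_space) measure)"
  "snd \<in> borel_measurable (borel :: ('a::topological_space \<times> 'b::topological_space) measure)"
  by (auto intro!: borel_measurable_continuous_onI continuous_intros)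

section \<open>Couplings and optimal plans as finite tables of weights\<close>

definition pmf_couplings :: "'a pmf \<Rightarrow> 'b pmf \<Rightarrow> ('a \<times> 'b) pmf set" where
  "pmf_couplings q r = {\<pi>. map_pmf fst \<pi> = q \<and> map_pmf snd \<pi> = r}"

lemma set_pmf_couplings:
  assumes "\<pi> \<in> pmf_couplings q r"
  shows "set_pmf \<pi> \<subseteq> set_pmf q \<times> set_pmf r"
  using assms by (force simp: pmf_couplings_def)

lemma finite_set_pmf_couplings:
  assumes "\<pi> \<in> pmf_couplings q r" "finite (set_pmf q)" "finite (set_pmf r)"
  shows "finite (set_pmf \<pi>)"
  using set_pmf_couplings[OF assms(1)] assms by (auto intro: finite_subset)

lemma pmf_map_fst_snd_finite:
  assumes "set_pmf u \<subseteq> Q \<times> R" "finite Q" "finite R"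
  shows "pmf (map_pmf fst u) x = (\<Sum>y\<in>R. pmf u (x, y))"
    and "pmf (map_pmf snd u) y = (\<Sum>x\<in>Q. pmf u (x, y))"
proof -
  have "pmf (map_pmf fst u) x = measure u ((\<lambda>y. (x, y)) ` R)"
    unfolding pmf_map using assms(1)
    by (intro measure_pmf.finite_measure_eq_AE) (auto simp: AE_measure_pmf_iff)
  also have "\<dots> = (\<Sum>y\<in>R. pmf u (x, y))"
    using assms by (subst measure_measure_pmf_finite) (auto simp: sum.reindex inj_on_def)
  finally show "pmf (map_pmf fst u) x = (\<Sum>y\<in>R. pmf u (x, y))" .
  have "pmf (map_pmf snd u) y = measure u ((\<lambda>x. (x, y)) ` Q)"
    unfolding pmf_map using assms(1)
    by (intro measure_pmf.finite_measure_eq_AE) (auto simp: AE_measure_pmf_iff)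
  also have "\<dots> = (\<Sum>x\<in>Q. pmf u (x, y))"
    using assms by (subst measure_measure_pmf_finite) (auto simp: sum.reindex inj_on_def)
  finally show "pmf (map_pmf snd u) y = (\<Sum>x\<in>Q. pmf u (x, y))" .
qed

text \<open>Being a coupling becomes finitely many linear equations in the weights. Compactness, the
  assembly of new plans and the prolongation of segments between plans all rely on this
  form.\<close>

lemma pmf_couplings_iff:
  assumes "finite (set_pmf q)" "finite (set_pmf r)" "set_pmf u \<subseteq> set_pmf q \<times> set_pmf r"
  shows "u \<in> pmf_couplings q r \<longleftrightarrow>
    (\<forall>x\<in>set_pmf q. (\<Sum>y\<in>set_pmf r. pmf u (x, y)) = pmf q x) \<and>
    (\<forall>y\<in>set_pmf r. (\<Sum>x\<in>set_pmf q. pmf u (x, y)) = pmf r y)" (is "_ \<longleftrightarrow> ?R")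
proof
  note * = pmf_map_fst_snd_finite[OF assms(3,1,2)]
  show "u \<in> pmf_couplings q r \<Longrightarrow> ?R"
    using * by (auto simp: pmf_couplings_def)
  assume R: ?R
  have "map_pmf fst u = q"
  proof (rule pmf_eqI)
    fix x
    show "pmf (map_pmf fst u) x = pmf q x"
    proof (cases "x \<in> set_pmf q")
      case False
      then have "x \<notin> set_pmf (map_pmf fst u)" using assms(3) by auto
      then show ?thesis using False by (simp only: set_pmf_iff not_not)
    qed (use R * in simp)
  qed
  moreover have "map_pmf snd u = r"
  proof (rule pmf_eqI)
    fix y
    show "pmf (map_pmf snd u) y = pmf r y"
    proof (cases "y \<in> set_pmf r")
      case False
      then have "y \<notin> set_pmf (map_pmf snd u)" using assms(3) by auto
      then show ?thesis using False by (simp only: set_pmf_iff not_not)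
    qed (use R * in simp)
  qed
  ultimately show "u \<in> pmf_couplings q r"
    by (simp add: pmf_couplings_def)
qed

lemma AE_couplings:
  assumes "\<pi> \<in> couplings \<rho> \<mu>"
  shows "AE x in \<rho>. P x \<Longrightarrow> AE z in \<pi>. P (fst z)"
    and "AE y in \<mu>. Q y \<Longrightarrow> AE z in \<pi>. Q (snd z)"
proof -
  from assms have "distr \<pi> borel fst = \<rho>" "distr \<pi> borel snd = \<mu>" "sets \<pi> = sets borel"
    by (auto simp: couplings_def borel_prob_def)
  moreover from this(3) have "fst \<in> measurable \<pi> borel" "snd \<in> measurable \<pi> borel"
    by (auto cong: measurable_cong_sets)
  ultimately show "AE x in \<rho>. P x \<Longrightarrow> AE z in \<pi>. P (fst z)"
    and "AE y in \<mu>. Q y \<Longrightarrow> AE z in \<pi>. Q (snd z)"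
    by (metis AE_distrD)+
qed

text \<open>A plan between finitely supported marginals is concentrated on the finite product of the
  supports, so no competitor is lost by passing to pmfs.\<close>

lemma couplings_borel_pmf:
  fixes q :: "'a::euclidean_space pmf" and r :: "'b::euclidean_space pmf"
  assumes "finite (set_pmf q)" "finite (set_pmf r)"
  shows "couplings (borel_pmf q) (borel_pmf r) = borel_pmf ` pmf_couplings q r"
proof (intro equalityI subsetI)
  fix \<pi> assume \<pi>: "\<pi> \<in> couplings (borel_pmf q) (borel_pmf r)"
  have "AE z in \<pi>. z \<in> set_pmf q \<times> set_pmf r"
    using AE_couplings(1)[OF \<pi> AE_borel_pmf_finite[OF assms(1)]]
      AE_couplings(2)[OF \<pi> AE_borel_pmf_finite[OF assms(2)]]
    by eventually_elim (auto simp: mem_Times_iff)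
  moreover have "borel_prob \<pi>" "finite (set_pmf q \<times> set_pmf r)"
    using \<pi> assms by (auto simp: couplings_def)
  ultimately obtain u where "\<pi> = borel_pmf u"
    using borel_pmf_finitely_supported by blast
  then show "\<pi> \<in> borel_pmf ` pmf_couplings q r"
    using \<pi> by (auto simp: couplings_def pmf_couplings_def distr_borel_pmf)
next
  fix \<pi> assume "\<pi> \<in> borel_pmf ` pmf_couplings q r"
  then show "\<pi> \<in> couplings (borel_pmf q) (borel_pmf r)"
    by (auto simp: couplings_def pmf_couplings_def distr_borel_pmf)
qed

definition pmf_cost :: "real \<Rightarrow> ('a::real_normed_vector \<times> 'a) pmf \<Rightarrow> real" where
  "pmf_cost p \<pi> = measure_pmf.expectation \<pi> (\<lambda>z. norm (fst z - snd z) powr p)"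

lemma pmf_cost_nonneg: "0 \<le> pmf_cost p \<pi>"
  by (simp add: pmf_cost_def)

lemma transport_cost_borel_pmf:
  fixes \<pi> :: "('a::euclidean_space \<times> 'a) pmf"
  assumes "finite (set_pmf \<pi>)"
  shows "transport_cost p (borel_pmf \<pi>) = ennreal (pmf_cost p \<pi>)"
  unfolding transport_cost_def pmf_cost_def
  by (subst nn_integral_borel_pmf, measurable)
    (intro nn_integral_eq_integral integrable_measure_pmf_finite assms, auto)

definition pmf_optimal ::
  "real \<Rightarrow> 'a::real_normed_vector pmf \<Rightarrow> 'a pmf \<Rightarrow> ('a \<times> 'a) pmf \<Rightarrow> bool" where
  "pmf_optimal p q r \<pi> \<longleftrightarrow>
     \<pi> \<in> pmf_couplings q r \<and> (\<forall>\<pi>'\<in>pmf_couplings q r. pmf_cost p \<pi> \<le> pmf_cost p \<pi>')"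

lemma optimal_plan_borel_pmf:
  fixes q r :: "'a::euclidean_space pmf"
  assumes "finite (set_pmf q)" "finite (set_pmf r)"
  shows "optimal_plan p (borel_pmf q) (borel_pmf r) \<gamma> \<longleftrightarrow> (\<exists>\<pi>. \<gamma> = borel_pmf \<pi> \<and> pmf_optimal p q r \<pi>)"
proof -
  have *: "transport_cost p (borel_pmf \<pi>) = ennreal (pmf_cost p \<pi>)" if "\<pi> \<in> pmf_couplings q r" for \<pi>
    using finite_set_pmf_couplings[OF that assms] by (rule transport_cost_borel_pmf)
  show ?thesis
    unfolding optimal_plan_def couplings_borel_pmf[OF assms] pmf_optimal_def
    by (auto simp: * pmf_cost_nonneg)
qed

lemma wasserstein_powr:
  assumes "0 < p"
  shows "wasserstein p \<rho> \<mu> powr p = enn2real (INF \<pi>\<in>couplings \<rho> \<mu>. transport_cost p \<pi>)"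
  using assms by (simp add: wasserstein_def powr_powr)

lemma wasserstein_powr_optimal:
  assumes "0 < p" "pmf_optimal p q r \<pi>" "finite (set_pmf q)" "finite (set_pmf r)"
  shows "wasserstein p (borel_pmf q) (borel_pmf r) powr p = pmf_cost p \<pi>"
proof -
  have "optimal_plan p (borel_pmf q) (borel_pmf r) (borel_pmf \<pi>)"
    using assms by (auto simp: optimal_plan_borel_pmf)
  then have "(INF \<pi>\<in>couplings (borel_pmf q) (borel_pmf r). transport_cost p \<pi>) = transport_cost p (borel_pmf \<pi>)"
    unfolding optimal_plan_def by (intro antisym INF_lower INF_greatest) auto
  also have "\<dots> = ennreal (pmf_cost p \<pi>)"
    using assms finite_set_pmf_couplings[of \<pi> q r]
    by (intro transport_cost_borel_pmf) (auto simp: pmf_optimal_def)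
  finally show ?thesis
    using assms(1) by (simp add: wasserstein_powr pmf_cost_nonneg)
qed

lemma wasserstein_powr_le:
  assumes "0 < p" "\<pi> \<in> pmf_couplings q r" "finite (set_pmf q)" "finite (set_pmf r)"
  shows "wasserstein p (borel_pmf q) (borel_pmf r) powr p \<le> pmf_cost p \<pi>"
proof -
  have "(INF \<pi>\<in>couplings (borel_pmf q) (borel_pmf r). transport_cost p \<pi>) \<le> transport_cost p (borel_pmf \<pi>)"
    using assms by (intro INF_lower) (auto simp: couplings_borel_pmf)
  also have "\<dots> = ennreal (pmf_cost p \<pi>)"
    using finite_set_pmf_couplings[OF assms(2-)] by (rule transport_cost_borel_pmf)
  finally show ?thesis
    using assms(1) by (simp add: wasserstein_powr enn2real_leI pmf_cost_nonneg)
qed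

text \<open>The cost is linear in the weights, hence continuous, and the admissible weights form a
  compact nonempty set: a product of compact factors cut by closed linear constraints.\<close>

lemma ex_pmf_optimal:
  fixes q r :: "'a::real_normed_vector pmf"
  assumes "finite (set_pmf q)" "finite (set_pmf r)"
  obtains \<pi> where "pmf_optimal p q r \<pi>"
proof -
  define S where "S = set_pmf q \<times> set_pmf r"
  \<comment> \<open>The factor \<open>{0}\<close> off \<open>S\<close> confines the support while
    the weights remain functions on the whole type, so that Tychonoff's theorem applies in the
    product topology.\<close>
  define K where "K = (\<lambda>z :: 'a \<times> 'a. if z \<in> S then {0..1::real} else {0})"
  define E where "E = {f. (\<forall>x\<in>set_pmf q. (\<Sum>y\<in>set_pmf r. f (x, y)) = pmf q x) \<and>
    (\<forall>y\<in>set_pmf r. (\<Sum>x\<in>set_pmf q. f (x, y)) = pmf r y)}"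
  define c where "c = (\<lambda>f. \<Sum>z\<in>S. f z * norm (fst z - snd z) powr p)"
  have finS: "finite S" using assms by (simp add: S_def)
  have sum1: "(\<Sum>x\<in>set_pmf q. pmf q x) = 1"
    using assms(1) sum_pmf_eq_1[of "set_pmf q" q] by simp
  have cost: "pmf_cost p u = c (pmf u)" if "set_pmf u \<subseteq> S" for u
    unfolding pmf_cost_def c_def using that finS
    by (subst integral_measure_pmf_real[of S]) (auto simp: mult.commute)
  have in_KE: "pmf u \<in> PiE UNIV K \<inter> E" if u: "u \<in> pmf_couplings q r" for u
  proof -
    have S: "set_pmf u \<subseteq> S"
      using set_pmf_couplings[OF u] by (simp add: S_def)
    then have "pmf u z \<in> K z" for z
      by (auto simp: K_def pmf_le_1 set_pmf_iff)
    moreover have "pmf u \<in> E"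
      using u pmf_couplings_iff[OF assms, of u] S by (auto simp: E_def S_def)
    ultimately show ?thesis by auto
  qed
  have "compactin (product_topology (\<lambda>_. euclidean) UNIV) (PiE UNIV K)"
    by (subst compactin_PiE) (auto simp: K_def)
  then have "compact (PiE UNIV K)"
    by (simp add: euclidean_product_topology)
  moreover have "closed E"
    unfolding E_def Collect_conj_eq Ball_def Collect_all_eq imp_conv_disj Collect_disj_eq
    by (intro closed_Int closed_INT closed_Un closed_Collect_eq continuous_on_sum ballI
        continuous_on_const continuous_on_product_coordinates closed_Collect_const)
  ultimately have comp: "compact (PiE UNIV K \<inter> E)"
    by (rule compact_Int_closed)
  have "pair_pmf q r \<in> pmf_couplings q r"
    by (simp add: pmf_couplings_def map_fst_pair_pmf map_snd_pair_pmf)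
  then have "PiE UNIV K \<inter> E \<noteq> {}"
    using in_KE by blast
  moreover have "continuous_on (PiE UNIV K \<inter> E) c"
  proof -
    have "continuous_on UNIV (\<lambda>f. f z * norm (fst z - snd z) powr p)" for z :: "'a \<times> 'a"
      by (rule continuous_on_mult_right[OF continuous_on_product_coordinates])
    then have "continuous_on UNIV c"
      unfolding c_def by (rule continuous_on_sum)
    then show ?thesis
      by (rule continuous_on_subset) simp
  qed
  ultimately have "\<exists>f\<in>PiE UNIV K \<inter> E. \<forall>g\<in>PiE UNIV K \<inter> E. c f \<le> c g"
    by (rule continuous_attains_inf[OF comp])
  then obtain f where f: "f \<in> PiE UNIV K" "f \<in> E"
    and min: "\<And>g. g \<in> PiE UNIV K \<inter> E \<Longrightarrow> c f \<le> c g"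
    by (elim bexE IntE) simp
  have fK: "f z \<in> K z" for z using f(1) by auto
  have "sum f S = 1"
    using f(2) sum1 by (simp add: S_def E_def sum.cartesian_product')
  moreover have "0 \<le> f z" if "z \<in> S" for z
    using fK[of z] that by (simp add: K_def)
  ultimately obtain u where u: "\<And>z. pmf u z = (if z \<in> S then f z else 0)" "set_pmf u \<subseteq> S"
    using obtain_pmf_of_weights[OF finS, of f] by blast
  have uf: "pmf u = f"
  proof
    show "pmf u z = f z" for z
      using u(1)[of z] fK[of z] by (simp add: K_def split: if_splits)
  qed
  have "u \<in> pmf_couplings q r"
    using pmf_couplings_iff[OF assms, of u] f(2) u(2) by (simp add: E_def S_def uf)
  moreover have "pmf_cost p u \<le> pmf_cost p v" if v: "v \<in> pmf_couplings q r" for v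
    using min[OF in_KE[OF v]] cost[OF u(2)] cost[of v] set_pmf_couplings[OF v]
    by (simp add: S_def uf)
  ultimately show ?thesis
    using that by (auto simp: pmf_optimal_def)
qed

subsection \<open>Plans with one discrete marginal\<close>

text \<open>A crude bound, enough to give every plan between measures with finite
  \<open>p\<close>-th moment a finite cost.\<close>

lemma powr_norm_diff_le:
  fixes x y :: "'a::real_normed_vector"
  assumes "0 \<le> p"
  shows "norm (x - y) powr p \<le> 2 powr p * (norm x powr p + norm y powr p)"
proof -
  have "norm (x - y) powr p \<le> (2 * max (norm x) (norm y)) powr p"
    using norm_triangle_ineq4[of x y] assms by (intro powr_mono2) auto
  also have "\<dots> = 2 powr p * max (norm x) (norm y) powr p"
    by (simp add: powr_mult)
  also have "\<dots> \<le> 2 powr p * (norm x powr p + norm y powr p)"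
    by (intro mult_left_mono) (auto simp: max_def)
  finally show ?thesis .
qed

text \<open>The product measure is a coupling; an infimum over no couplings would be
  infinite.\<close>

lemma couplings_nonempty:
  fixes \<rho> :: "'a::euclidean_space measure" and \<mu> :: "'b::euclidean_space measure"
  assumes "borel_prob \<rho>" "borel_prob \<mu>"
  shows "couplings \<rho> \<mu> \<noteq> {}"
proof -
  interpret \<rho>: prob_space \<rho> using assms by (simp add: borel_prob_def)
  interpret \<mu>: prob_space \<mu> using assms by (simp add: borel_prob_def)
  interpret P: pair_prob_space \<rho> \<mu> ..
  have s: "sets \<rho> = sets borel" "sets \<mu> = sets borel"
    using assms by (auto simp: borel_prob_def)
  have "sets (\<rho> \<Otimes>\<^sub>M \<mu>) = sets borel"
    unfolding borel_prod[symmetric] by (intro sets_pair_measure_cong s)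
  moreover have "distr (\<rho> \<Otimes>\<^sub>M \<mu>) borel fst = distr (\<rho> \<Otimes>\<^sub>M \<mu>) \<rho> fst"
    "distr (\<rho> \<Otimes>\<^sub>M \<mu>) borel snd = distr (\<rho> \<Otimes>\<^sub>M \<mu>) \<mu> snd"
    using s by (auto intro!: distr_cong)
  moreover have "distr (\<rho> \<Otimes>\<^sub>M \<mu>) \<mu> snd = \<mu>"
  proof (rule measure_eqI)
    fix A assume "A \<in> sets (distr (\<rho> \<Otimes>\<^sub>M \<mu>) \<mu> snd)"
    then have A: "A \<in> sets \<mu>" by simp
    have "snd -` A \<inter> space (\<rho> \<Otimes>\<^sub>M \<mu>) = space \<rho> \<times> A"
      using sets.sets_into_space[OF A] by (auto simp: space_pair_measure)
    then show "emeasure (distr (\<rho> \<Otimes>\<^sub>M \<mu>) \<mu> snd) A = emeasure \<mu> A"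
      using A by (simp add: emeasure_distr \<mu>.emeasure_pair_measure_Times \<rho>.emeasure_space_1)
  qed simp
  ultimately have "\<rho> \<Otimes>\<^sub>M \<mu> \<in> couplings \<rho> \<mu>"
    using P.prob_space_axioms \<mu>.distr_pair_fst
    by (simp add: couplings_def borel_prob_def)
  then show ?thesis by blast
qed

lemma measurable_couplings:
  assumes "\<pi> \<in> couplings \<rho> \<mu>"
  shows "measurable \<pi> N = measurable borel N"
  using assms by (intro measurable_cong_sets) (auto simp: couplings_def borel_prob_def)

lemma nn_integral_couplings:
  assumes "\<pi> \<in> couplings \<rho> \<mu>"
  shows "f \<in> borel_measurable borel \<Longrightarrow> (\<integral>\<^sup>+z. f (fst z) \<partial>\<pi>) = (\<integral>\<^sup>+x. f x \<partial>\<rho>)"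
    and "g \<in> borel_measurable borel \<Longrightarrow> (\<integral>\<^sup>+z. g (snd z) \<partial>\<pi>) = (\<integral>\<^sup>+y. g y \<partial>\<mu>)"
proof -
  have m: "fst \<in> measurable \<pi> borel" "snd \<in> measurable \<pi> borel"
    unfolding measurable_couplings[OF assms] by measurable
  have "\<rho> = distr \<pi> borel fst" "\<mu> = distr \<pi> borel snd"
    using assms by (auto simp: couplings_def)
  then show "f \<in> borel_measurable borel \<Longrightarrow> (\<integral>\<^sup>+z. f (fst z) \<partial>\<pi>) = (\<integral>\<^sup>+x. f x \<partial>\<rho>)"
    and "g \<in> borel_measurable borel \<Longrightarrow> (\<integral>\<^sup>+z. g (snd z) \<partial>\<pi>) = (\<integral>\<^sup>+y. g y \<partial>\<mu>)"
    using m by (simp_all add: nn_integral_distr)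
qed

lemma transport_cost_finite:
  fixes \<rho> \<mu> :: "'a::euclidean_space measure"
  assumes "0 \<le> p" "\<rho> \<in> wasserstein_space p" "\<mu> \<in> wasserstein_space p" "\<pi> \<in> couplings \<rho> \<mu>"
  shows "transport_cost p \<pi> < \<infinity>"
proof -
  note [simp] = measurable_couplings[OF assms(4)]
  have "transport_cost p \<pi> \<le> (\<integral>\<^sup>+z. ennreal (2 powr p) *
      (ennreal (norm (fst z) powr p) + ennreal (norm (snd z) powr p)) \<partial>\<pi>)"
    unfolding transport_cost_def using powr_norm_diff_le[OF assms(1)]
    by (intro nn_integral_mono) (simp flip: ennreal_plus ennreal_mult)
  also have "\<dots> = ennreal (2 powr p) *
      ((\<integral>\<^sup>+z. ennreal (norm (fst z) powr p) \<partial>\<pi>) + (\<integral>\<^sup>+z. ennreal (norm (snd z) powr p) \<partial>\<pi>))"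
    by (subst nn_integral_cmult, simp) (subst nn_integral_add, simp_all)
  also have "\<dots> = ennreal (2 powr p) *
      ((\<integral>\<^sup>+x. ennreal (norm x powr p) \<partial>\<rho>) + (\<integral>\<^sup>+y. ennreal (norm y powr p) \<partial>\<mu>))"
    using nn_integral_couplings[OF assms(4), of "\<lambda>x. ennreal (norm x powr p)"] by simp
  also have "\<dots> < \<infinity>"
    using assms(2,3) by (simp add: wasserstein_space_def ennreal_mult_less_top)
  finally show ?thesis .
qed

text \<open>\<open>enn2real\<close> would send an infinite infimum to \<open>0\<close>. Existence of
  a coupling and finite moments exclude this, so prescribed distances determine the actual
  infima.\<close>

lemma ennreal_wasserstein_powr:
  fixes \<rho> \<mu> :: "'a::euclidean_space measure"
  assumes "0 < p" "\<rho> \<in> wasserstein_space p" "\<mu> \<in> wasserstein_space p"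
  shows "ennreal (wasserstein p \<rho> \<mu> powr p) = (INF \<pi>\<in>couplings \<rho> \<mu>. transport_cost p \<pi>)"
proof -
  obtain \<pi> where \<pi>: "\<pi> \<in> couplings \<rho> \<mu>"
    using couplings_nonempty[of \<rho> \<mu>] assms by (auto simp: wasserstein_space_def)
  have "(INF \<pi>\<in>couplings \<rho> \<mu>. transport_cost p \<pi>) \<le> transport_cost p \<pi>"
    using \<pi> by (rule INF_lower)
  also have "\<dots> < \<infinity>"
    using assms \<pi> by (intro transport_cost_finite) auto
  finally show ?thesis
    using assms(1) by (simp add: wasserstein_powr less_top)
qed

text \<open>Disintegration expects the discrete marginal in the first place; a plan that ends in a
  discrete measure is reversed to meet this.\<close>

lemma couplings_swap:
  fixes \<rho> \<mu> :: "'a::euclidean_space measure"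
  assumes "\<pi> \<in> couplings \<rho> \<mu>"
  shows "distr \<pi> borel prod.swap \<in> couplings \<mu> \<rho>"
    and "transport_cost p (distr \<pi> borel prod.swap) = transport_cost p \<pi>"
proof -
  have sw: "prod.swap \<in> measurable \<pi> (borel :: ('a \<times> 'a) measure)"
    unfolding measurable_couplings[OF assms]
    by (intro borel_measurable_continuous_onI continuous_intros)
  show "distr \<pi> borel prod.swap \<in> couplings \<mu> \<rho>"
    using assms sw
    by (auto simp: couplings_def borel_prob_def distr_distr prob_space.prob_space_distr comp_def)
  show "transport_cost p (distr \<pi> borel prod.swap) = transport_cost p \<pi>"
    unfolding transport_cost_def using sw
    by (subst nn_integral_distr) (simp_all add: norm_minus_commute)
qed

text \<open>The conditional weights \<open>f x z\<close> of \<open>x\<close> given \<open>z\<close> are Radon--Nikodym densities: as the first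
  marginal is discrete, no general disintegration theorem is needed.\<close>

lemma semidiscrete_disintegration:
  fixes q :: "'a::euclidean_space pmf" and \<nu> :: "'b::euclidean_space measure"
  assumes fin: "finite (set_pmf q)" and \<sigma>: "\<sigma> \<in> couplings (borel_pmf q) \<nu>" and \<nu>: "borel_prob \<nu>"
  obtains f where "\<And>x. f x \<in> borel_measurable borel"
    "AE z in \<nu>. (\<Sum>x\<in>set_pmf q. f x z) = 1"
    "\<And>F. F \<in> borel_measurable borel \<Longrightarrow>
      (\<integral>\<^sup>+w. F w \<partial>\<sigma>) = (\<Sum>x\<in>set_pmf q. \<integral>\<^sup>+z. f x z * F (x, z) \<partial>\<nu>)"
proof -
  note [simp] = measurable_couplings[OF \<sigma>]
  have sets\<nu>: "sets \<nu> = sets borel" using \<nu> by (simp add: borel_prob_def)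
  have [simp]: "measurable \<nu> N = measurable borel N" for N :: "'c measure"
    using sets\<nu> by (intro measurable_cong_sets) auto
  interpret prob_space \<nu> using \<nu> by (simp add: borel_prob_def)
  define I where "I = (\<lambda>x (w :: 'a \<times> 'b). indicator {x} (fst w) :: ennreal)"
  \<comment> \<open>The part of \<open>\<sigma>\<close> lying over the atom \<open>x\<close>, seen
    on the second factor. It is dominated by the second marginal \<open>\<nu>\<close>, hence has a
    density.\<close>
  define \<sigma>' where "\<sigma>' = (\<lambda>x. distr (density \<sigma> (I x)) borel snd)"
  define f where "f = (\<lambda>x. RN_deriv \<nu> (\<sigma>' x))"
  have [measurable]: "I x \<in> borel_measurable borel" for x
    unfolding I_def by measurable
  have snd: "snd \<in> measurable (density \<sigma> (I x)) borel" for x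
    by simp
  have sets\<sigma>': "sets (\<sigma>' x) = sets \<nu>" for x
    by (simp add: \<sigma>'_def sets\<nu>)
  have int\<sigma>': "(\<integral>\<^sup>+z. G z \<partial>\<sigma>' x) = (\<integral>\<^sup>+w. I x w * G (snd w) \<partial>\<sigma>)" if "G \<in> borel_measurable borel" for G x
    unfolding \<sigma>'_def using that snd
    by (subst nn_integral_distr) (auto intro!: nn_integral_density)
  have ac: "absolutely_continuous \<nu> (\<sigma>' x)" for x
    unfolding absolutely_continuous_def
  proof
    fix N assume N: "N \<in> null_sets \<nu>"
    then have Nb: "N \<in> sets borel" by (auto simp: null_sets_def sets\<nu>)
    have "emeasure (\<sigma>' x) N = (\<integral>\<^sup>+w. I x w * indicator N (snd w) \<partial>\<sigma>)"
      using Nb int\<sigma>'[of "indicator N" x] sets\<sigma>' sets\<nu> by simp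
    also have "\<dots> \<le> (\<integral>\<^sup>+w. indicator N (snd w) \<partial>\<sigma>)"
      by (intro nn_integral_mono) (auto simp: I_def indicator_def)
    also have "\<dots> = (\<integral>\<^sup>+z. indicator N z \<partial>\<nu>)"
      using Nb by (intro nn_integral_couplings[OF \<sigma>]) simp
    also have "\<dots> = 0"
      using N by (simp add: null_sets_def)
    finally show "N \<in> null_sets (\<sigma>' x)"
      using N sets\<sigma>'[of x] by (auto simp: null_sets_def)
  qed
  have fm[measurable]: "f x \<in> borel_measurable borel" for x
    using borel_measurable_RN_deriv[of \<nu> "\<sigma>' x"] unfolding f_def by simp
  have dens: "density \<nu> (f x) = \<sigma>' x" for x
    unfolding f_def by (rule density_RN_deriv[OF ac sets\<sigma>'])
  have int: "(\<integral>\<^sup>+w. F w \<partial>\<sigma>) = (\<Sum>x\<in>set_pmf q. \<integral>\<^sup>+z. f x z * F (x, z) \<partial>\<nu>)"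
    if F[measurable]: "F \<in> borel_measurable borel" for F
  proof -
    have Fx[measurable]: "(\<lambda>z. F (x, z)) \<in> borel_measurable borel" for x
      by (intro measurable_compose[OF _ F] borel_measurable_continuous_onI continuous_intros)
    have "AE w in \<sigma>. fst w \<in> set_pmf q"
      using AE_couplings(1)[OF \<sigma> AE_borel_pmf_finite[OF fin]] .
    then have "(\<integral>\<^sup>+w. F w \<partial>\<sigma>) = (\<integral>\<^sup>+w. (\<Sum>x\<in>set_pmf q. I x w * F (x, snd w)) \<partial>\<sigma>)"
    proof (intro nn_integral_cong_AE, eventually_elim)
      case (elim w)
      have "(\<Sum>x\<in>set_pmf q. I x w * F (x, snd w)) = (\<Sum>x\<in>{fst w}. I x w * F (x, snd w))"
        using elim fin by (intro sum.mono_neutral_right) (auto simp: I_def)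
      then show ?case by (simp add: I_def)
    qed
    also have "\<dots> = (\<Sum>x\<in>set_pmf q. \<integral>\<^sup>+w. I x w * F (x, snd w) \<partial>\<sigma>)"
      by (intro nn_integral_sum) simp
    also have "\<dots> = (\<Sum>x\<in>set_pmf q. \<integral>\<^sup>+z. f x z * F (x, z) \<partial>\<nu>)"
      by (intro sum.cong refl, subst int\<sigma>'[symmetric], simp, subst dens[symmetric])
        (auto intro!: nn_integral_density)
    finally show ?thesis .
  qed
  \<comment> \<open>Summed over the atoms, the parts give back \<open>\<nu>\<close>, whose density
    is 1; uniqueness of densities yields the normalisation.\<close>
  have "density \<nu> (\<lambda>z. \<Sum>x\<in>set_pmf q. f x z) = density \<nu> (\<lambda>_. 1)"
  proof (rule measure_eqI)
    fix A assume "A \<in> sets (density \<nu> (\<lambda>z. \<Sum>x\<in>set_pmf q. f x z))"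
    then have A[measurable]: "A \<in> sets borel" by (simp add: sets\<nu>)
    have "emeasure (density \<nu> (\<lambda>z. \<Sum>x\<in>set_pmf q. f x z)) A =
        (\<integral>\<^sup>+z. (\<Sum>x\<in>set_pmf q. f x z * indicator A z) \<partial>\<nu>)"
      by (subst emeasure_density) (auto simp: sum_distrib_right sets\<nu>)
    also have "\<dots> = (\<Sum>x\<in>set_pmf q. \<integral>\<^sup>+z. f x z * indicator A z \<partial>\<nu>)"
      by (intro nn_integral_sum) simp
    also have "\<dots> = (\<integral>\<^sup>+w. indicator A (snd w) \<partial>\<sigma>)"
      by (subst int) simp_all
    also have "\<dots> = (\<integral>\<^sup>+z. indicator A z \<partial>\<nu>)"
      by (intro nn_integral_couplings[OF \<sigma>]) simp
    finally show "emeasure (density \<nu> (\<lambda>z. \<Sum>x\<in>set_pmf q. f x z)) A = emeasure (density \<nu> (\<lambda>_. 1)) A"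
      by (simp add: density_1 sets\<nu>)
  qed simp
  then have "AE z in \<nu>. (\<Sum>x\<in>set_pmf q. f x z) = 1"
    by (intro density_unique) auto
  then show ?thesis
    using that fm int by blast
qed

text \<open>A triangle inequality with remainder \<open>m\<close>. The products
  \<open>f x z * g y z\<close> are the weights of the gluing of \<open>\<sigma>\<close> and
  \<open>\<tau>\<close> that is conditionally independent given \<open>z\<close>. Forgetting
  \<open>z\<close> leaves a coupling of \<open>q\<close> and \<open>r\<close>, whose cost bounds the
  Wasserstein term from above; averaging \<open>le\<close> with the same weights gives the
  claim.\<close>

lemma semidiscrete_excess:
  fixes q r :: "'a::euclidean_space pmf" and \<nu> :: "'b::euclidean_space measure"
  assumes p: "0 < p" and fin: "finite (set_pmf q)" "finite (set_pmf r)" and \<nu>: "borel_prob \<nu>"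
    and \<sigma>: "\<sigma> \<in> couplings (borel_pmf q) \<nu>" and \<tau>: "\<tau> \<in> couplings (borel_pmf r) \<nu>"
    and [measurable]: "G \<in> borel_measurable borel" "H \<in> borel_measurable borel"
      "m \<in> borel_measurable borel"
    and le: "\<And>x y z. x \<in> set_pmf q \<Longrightarrow> y \<in> set_pmf r \<Longrightarrow>
      ennreal (norm (x - y) powr p) + m z \<le> G (x, z) + H (y, z)"
  shows "ennreal (wasserstein p (borel_pmf q) (borel_pmf r) powr p) + (\<integral>\<^sup>+z. m z \<partial>\<nu>)
    \<le> (\<integral>\<^sup>+w. G w \<partial>\<sigma>) + (\<integral>\<^sup>+w. H w \<partial>\<tau>)"
proof -
  have sets\<nu>: "sets \<nu> = sets borel" using \<nu> by (simp add: borel_prob_def)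
  have [simp]: "measurable \<nu> N = measurable borel N" for N :: "'c measure"
    using sets\<nu> by (intro measurable_cong_sets) auto
  interpret prob_space \<nu> using \<nu> by (simp add: borel_prob_def)
  obtain f where f[measurable]: "\<And>x. f x \<in> borel_measurable borel"
    and f1: "AE z in \<nu>. (\<Sum>x\<in>set_pmf q. f x z) = 1"
    and fint: "\<And>F. F \<in> borel_measurable borel \<Longrightarrow>
      (\<integral>\<^sup>+w. F w \<partial>\<sigma>) = (\<Sum>x\<in>set_pmf q. \<integral>\<^sup>+z. f x z * F (x, z) \<partial>\<nu>)"
    using semidiscrete_disintegration[OF fin(1) \<sigma> \<nu>] by blast
  obtain g where g[measurable]: "\<And>x. g x \<in> borel_measurable borel"
    and g1: "AE z in \<nu>. (\<Sum>y\<in>set_pmf r. g y z) = 1"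
    and gint: "\<And>F. F \<in> borel_measurable borel \<Longrightarrow>
      (\<integral>\<^sup>+w. F w \<partial>\<tau>) = (\<Sum>y\<in>set_pmf r. \<integral>\<^sup>+z. g y z * F (y, z) \<partial>\<nu>)"
    using semidiscrete_disintegration[OF fin(2) \<tau> \<nu>] by blast
  have [measurable]: "(\<lambda>z. F (x, z)) \<in> borel_measurable borel"
    if F: "F \<in> borel_measurable borel" for x :: 'a and F :: "'a \<times> 'b \<Rightarrow> ennreal"
    by (intro measurable_compose[OF _ F] borel_measurable_continuous_onI continuous_intros)
  define S where "S = set_pmf q \<times> set_pmf r"
  have finS: "finite S" using fin by (simp add: S_def)
  \<comment> \<open>The mass that the gluing puts on \<open>(x, y)\<close> once \<open>z\<close> is
    integrated out.\<close>
  define A where "A = (\<lambda>(x, y). \<integral>\<^sup>+z. f x z * g y z \<partial>\<nu>)"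
  define a where "a = (\<lambda>w. enn2real (A w))"
  have Ax: "(\<Sum>y\<in>set_pmf r. A (x, y)) = ennreal (pmf q x)" if x: "x \<in> set_pmf q" for x
  proof -
    have "(\<Sum>y\<in>set_pmf r. A (x, y)) = (\<integral>\<^sup>+z. (\<Sum>y\<in>set_pmf r. f x z * g y z) \<partial>\<nu>)"
      unfolding A_def by (subst nn_integral_sum) simp_all
    also have "\<dots> = (\<integral>\<^sup>+z. f x z \<partial>\<nu>)"
      using g1 by (intro nn_integral_cong_AE) (auto simp: sum_distrib_left[symmetric])
    \<comment> \<open>Testing the disintegration against the indicator of \<open>x\<close> singles
      out \<open>f x\<close>, whose integral is then read off from the first marginal of
      \<open>\<sigma>\<close>.\<close>
    also have "\<dots> = (\<Sum>u\<in>set_pmf q. \<integral>\<^sup>+z. f u z * indicator {x} (fst (u, z)) \<partial>\<nu>)"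
      using fin x by (subst sum.remove[of _ x]) (auto intro!: sum.neutral)
    also have "\<dots> = (\<integral>\<^sup>+w. indicator {x} (fst w) \<partial>\<sigma>)"
      by (subst fint) simp_all
    also have "\<dots> = (\<integral>\<^sup>+u. indicator {x} u \<partial>borel_pmf q)"
      by (intro nn_integral_couplings[OF \<sigma>]) simp
    also have "\<dots> = ennreal (pmf q x)"
      by (simp add: emeasure_borel_pmf emeasure_pmf_single)
    finally show ?thesis .
  qed
  have Ay: "(\<Sum>x\<in>set_pmf q. A (x, y)) = ennreal (pmf r y)" if y: "y \<in> set_pmf r" for y
  proof -
    have "(\<Sum>x\<in>set_pmf q. A (x, y)) = (\<integral>\<^sup>+z. (\<Sum>x\<in>set_pmf q. f x z * g y z) \<partial>\<nu>)"
      unfolding A_def by (subst nn_integral_sum) simp_all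
    also have "\<dots> = (\<integral>\<^sup>+z. g y z \<partial>\<nu>)"
      using f1 by (intro nn_integral_cong_AE) (auto simp: sum_distrib_right[symmetric])
    also have "\<dots> = (\<Sum>u\<in>set_pmf r. \<integral>\<^sup>+z. g u z * indicator {y} (fst (u, z)) \<partial>\<nu>)"
      using fin y by (subst sum.remove[of _ y]) (auto intro!: sum.neutral)
    also have "\<dots> = (\<integral>\<^sup>+w. indicator {y} (fst w) \<partial>\<tau>)"
      by (subst gint) simp_all
    also have "\<dots> = (\<integral>\<^sup>+u. indicator {y} u \<partial>borel_pmf r)"
      by (intro nn_integral_couplings[OF \<tau>]) simp
    also have "\<dots> = ennreal (pmf r y)"
      by (simp add: emeasure_borel_pmf emeasure_pmf_single)
    finally show ?thesis .
  qed
  have Aa: "A w = ennreal (a w)" if "w \<in> S" for w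
  proof -
    obtain x y where w: "w = (x, y)" "x \<in> set_pmf q" "y \<in> set_pmf r"
      using \<open>w \<in> S\<close> unfolding S_def by (elim SigmaE)
    then have "A w \<le> ennreal (pmf q x)"
      unfolding Ax[OF w(2), symmetric] using fin by (auto intro!: member_le_sum)
    then have "A w < top"
      using ennreal_less_top order_le_less_trans by blast
    then show ?thesis by (simp add: a_def)
  qed
  have a0: "0 \<le> a w" for w by (simp add: a_def)
  have ax: "(\<Sum>y\<in>set_pmf r. a (x, y)) = pmf q x" if "x \<in> set_pmf q" for x
  proof -
    have "ennreal (\<Sum>y\<in>set_pmf r. a (x, y)) = ennreal (pmf q x)"
      unfolding Ax[OF that, symmetric] sum_ennreal[OF a0, symmetric] using that
      by (intro sum.cong refl Aa[symmetric]) (simp add: S_def)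
    then show ?thesis by (simp add: a0 sum_nonneg)
  qed
  have ay: "(\<Sum>x\<in>set_pmf q. a (x, y)) = pmf r y" if "y \<in> set_pmf r" for y
  proof -
    have "ennreal (\<Sum>x\<in>set_pmf q. a (x, y)) = ennreal (pmf r y)"
      unfolding Ay[OF that, symmetric] sum_ennreal[OF a0, symmetric] using that
      by (intro sum.cong refl Aa[symmetric]) (simp add: S_def)
    then show ?thesis by (simp add: a0 sum_nonneg)
  qed
  have "sum a S = (\<Sum>x\<in>set_pmf q. pmf q x)"
    by (simp add: S_def sum.cartesian_product' ax)
  also have "\<dots> = 1"
    using fin(1) sum_pmf_eq_1[of "set_pmf q" q] by simp
  finally obtain u where u: "\<And>w. pmf u w = (if w \<in> S then a w else 0)" "set_pmf u \<subseteq> S"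
    using obtain_pmf_of_weights[OF finS, of a] a0 by blast
  have "u \<in> pmf_couplings q r"
    using pmf_couplings_iff[OF fin, of u] u ax ay by (simp add: S_def)
  then have "ennreal (wasserstein p (borel_pmf q) (borel_pmf r) powr p) \<le> ennreal (pmf_cost p u)"
    using p fin by (intro ennreal_leI wasserstein_powr_le)
  also have "pmf_cost p u = (\<Sum>w\<in>S. a w * norm (fst w - snd w) powr p)"
    unfolding pmf_cost_def using u finS
    by (subst integral_measure_pmf_real[of S]) (auto simp: mult.commute intro!: sum.cong)
  also have "ennreal \<dots> = (\<Sum>w\<in>S. A w * ennreal (norm (fst w - snd w) powr p))"
    by (subst sum_ennreal[symmetric]) (auto simp: a0 Aa ennreal_mult)
  also have "\<dots> = (\<integral>\<^sup>+z. (\<Sum>(x, y)\<in>S. f x z * g y z * ennreal (norm (x - y) powr p)) \<partial>\<nu>)"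
    by (subst nn_integral_sum) (auto simp: A_def nn_integral_multc split_beta intro!: sum.cong)
  finally have "ennreal (wasserstein p (borel_pmf q) (borel_pmf r) powr p) + (\<integral>\<^sup>+z. m z \<partial>\<nu>)
      \<le> (\<integral>\<^sup>+z. (\<Sum>(x, y)\<in>S. f x z * g y z * ennreal (norm (x - y) powr p)) \<partial>\<nu>) + (\<integral>\<^sup>+z. m z \<partial>\<nu>)"
    by (rule add_right_mono)
  also have "\<dots> = (\<integral>\<^sup>+z. (\<Sum>(x, y)\<in>S. f x z * g y z * ennreal (norm (x - y) powr p)) + m z \<partial>\<nu>)"
    by (subst nn_integral_add) (auto simp: split_beta)
  also have "\<dots> \<le> (\<integral>\<^sup>+z. (\<Sum>x\<in>set_pmf q. f x z * G (x, z)) + (\<Sum>y\<in>set_pmf r. g y z * H (y, z)) \<partial>\<nu>)"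
    using f1 g1
  proof (intro nn_integral_mono_AE, eventually_elim)
    case (elim z)
    \<comment> \<open>At fixed \<open>z\<close> the product weights have total mass one, so a term
      free of \<open>x\<close> and \<open>y\<close> may be moved under the sum.\<close>
    have one: "(\<Sum>(x, y)\<in>S. f x z * g y z * c) = c" for c
      using elim unfolding S_def
      by (simp add: sum.cartesian_product[symmetric] sum_distrib_left[symmetric] sum_distrib_right[symmetric])
    have "(\<Sum>(x, y)\<in>S. f x z * g y z * ennreal (norm (x - y) powr p)) + m z
        = (\<Sum>(x, y)\<in>S. f x z * g y z * (ennreal (norm (x - y) powr p) + m z))"
      by (subst one[of "m z", symmetric])
        (simp add: sum.distrib[symmetric] distrib_left split_beta)
    also have "\<dots> \<le> (\<Sum>(x, y)\<in>S. f x z * g y z * (G (x, z) + H (y, z)))"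
      by (intro sum_mono) (auto simp: S_def intro!: mult_left_mono le)
    also have "\<dots> = (\<Sum>x\<in>set_pmf q. f x z * G (x, z) * (\<Sum>y\<in>set_pmf r. g y z))
        + (\<Sum>y\<in>set_pmf r. g y z * H (y, z) * (\<Sum>x\<in>set_pmf q. f x z))"
    proof -
      have "(\<Sum>(x, y)\<in>S. f x z * g y z * (G (x, z) + H (y, z))) =
          (\<Sum>x\<in>set_pmf q. \<Sum>y\<in>set_pmf r. f x z * G (x, z) * g y z)
          + (\<Sum>x\<in>set_pmf q. \<Sum>y\<in>set_pmf r. g y z * H (y, z) * f x z)"
        by (simp add: S_def sum.cartesian_product[symmetric] distrib_left sum.distrib mult_ac)
      also have "(\<Sum>x\<in>set_pmf q. \<Sum>y\<in>set_pmf r. g y z * H (y, z) * f x z)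
          = (\<Sum>y\<in>set_pmf r. \<Sum>x\<in>set_pmf q. g y z * H (y, z) * f x z)"
        by (rule sum.swap)
      finally show ?thesis
        by (simp add: sum_distrib_left)
    qed
    also have "\<dots> = (\<Sum>x\<in>set_pmf q. f x z * G (x, z)) + (\<Sum>y\<in>set_pmf r. g y z * H (y, z))"
      using elim by simp
    finally show ?case .
  qed
  also have "\<dots> = (\<integral>\<^sup>+w. G w \<partial>\<sigma>) + (\<integral>\<^sup>+w. H w \<partial>\<tau>)"
    by (subst nn_integral_add) (simp_all add: nn_integral_sum fint gint)
  finally show ?thesis .
qed

section \<open>Finite support of intermediate measures\<close>

lemma ennreal_le_affine_Inf:
  fixes c :: ennreal and k l :: real
  assumes "0 < k" "0 < l" "\<And>a b. a \<in> A \<Longrightarrow> b \<in> B \<Longrightarrow> c \<le> ennreal k * f a + ennreal l * g b"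
  shows "c \<le> ennreal k * (INF a\<in>A. f a) + ennreal l * (INF b\<in>B. g b)"
proof (rule ennreal_le_epsilon)
  fix e :: real
  assume fin: "ennreal k * (INF a\<in>A. f a) + ennreal l * (INF b\<in>B. g b) < top" and e: "0 < e"
  \<comment> \<open>With this tolerance for both near-minimisers the weighted errors
    \<open>k * d\<close> and \<open>l * d\<close> add up to exactly \<open>e\<close>.\<close>
  define d where "d = e / (k + l)"
  have d: "0 < d" "k * d + l * d = e"
    using e assms(1,2) by (simp_all add: d_def add_divide_distrib[symmetric] distrib_right[symmetric])
  have "v \<noteq> \<infinity>" if "ennreal u * v < top" "0 < u" for u v
    using that by (auto simp: ennreal_mult_top)
  then have "(INF a\<in>A. f a) \<noteq> \<infinity>" "(INF b\<in>B. g b) \<noteq> \<infinity>"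
    using fin assms(1,2) by (metis ennreal_add_less_top)+
  then obtain a b where ab: "a \<in> A" "f a < (INF a\<in>A. f a) + d" "b \<in> B" "g b < (INF b\<in>B. g b) + d"
    using INF_approx_ennreal[OF d(1) refl, of f A] INF_approx_ennreal[OF d(1) refl, of g B] by blast
  have "c \<le> ennreal k * f a + ennreal l * g b"
    using ab assms by simp
  also have "\<dots> \<le> ennreal k * ((INF a\<in>A. f a) + d) + ennreal l * ((INF b\<in>B. g b) + d)"
    using ab by (intro add_mono mult_left_mono) auto
  also have "\<dots> = ennreal k * (INF a\<in>A. f a) + ennreal l * (INF b\<in>B. g b) + (ennreal k * d + ennreal l * d)"
    by (simp add: distrib_left add_ac)
  also have "ennreal k * d + ennreal l * d = ennreal e"
    using d assms(1,2) by (simp flip: ennreal_mult ennreal_plus)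
  finally show "c \<le> ennreal k * (INF a\<in>A. f a) + ennreal l * (INF b\<in>B. g b) + ennreal e" .
qed

text \<open>Convexity applied to the velocities \<open>v = (x - z) / t\<close> and
  \<open>w = (z - y) / (1 - t)\<close>, whose weighted mean is \<open>x - y\<close>; rescaling
  produces the factors \<open>t powr (1 - p)\<close> and \<open>(1 - t) powr (1 - p)\<close>.
  Equality forces equal velocities, which places \<open>z\<close> on the segment at proportion
  \<open>t\<close>.\<close>

lemma norm_diff_powr_le_split:
  fixes x y z :: "'a::real_inner"
  assumes "1 < p" "0 < t" "t < 1"
  shows "norm (x - y) powr p \<le>
      t powr (1 - p) * norm (x - z) powr p + (1 - t) powr (1 - p) * norm (z - y) powr p"
    and "norm (x - y) powr p =
      t powr (1 - p) * norm (x - z) powr p + (1 - t) powr (1 - p) * norm (z - y) powr p \<Longrightarrow>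
      z = (1 - t) *\<^sub>R x + t *\<^sub>R y"
proof -
  define v w where "v = (1 / t) *\<^sub>R (x - z)" and "w = (1 / (1 - t)) *\<^sub>R (z - y)"
  have xy: "x - y = t *\<^sub>R v + (1 - t) *\<^sub>R w"
    using assms by (simp add: v_def w_def)
  have *: "s * (a / s) powr p = s powr (1 - p) * a powr p" if "0 < s" "0 \<le> a" for s a :: real
    using that by (simp add: powr_divide powr_diff)
  have v: "t * norm v powr p = t powr (1 - p) * norm (x - z) powr p"
    using assms *[of t "norm (x - z)"] by (simp add: v_def)
  have w: "(1 - t) * norm w powr p = (1 - t) powr (1 - p) * norm (z - y) powr p"
    using assms *[of "1 - t" "norm (z - y)"] by (simp add: w_def)
  show "norm (x - y) powr p \<le>
      t powr (1 - p) * norm (x - z) powr p + (1 - t) powr (1 - p) * norm (z - y) powr p"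
    using norm_powr_convex(1)[OF assms, of v w] unfolding xy v w .
  assume "norm (x - y) powr p =
      t powr (1 - p) * norm (x - z) powr p + (1 - t) powr (1 - p) * norm (z - y) powr p"
  then have "v = w"
    using norm_powr_convex(2)[OF assms, of v w] unfolding xy v w by simp
  then have "x - y = v"
    using xy by (simp add: algebra_simps)
  then have "x - z = t *\<^sub>R (x - y)"
    using assms by (simp add: v_def)
  then show "z = (1 - t) *\<^sub>R x + t *\<^sub>R y"
    by (simp add: algebra_simps)
qed

text \<open>At the distances \<open>t * W\<close> and \<open>(1 - t) * W\<close> the two weighted
  terms of the split inequality become \<open>t * W powr p\<close> and
  \<open>(1 - t) * W powr p\<close>, with sum exactly \<open>W powr p\<close>: a geodesic leaves no
  slack.\<close>

lemma powr_one_minus_mult_powr: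
  fixes t W p :: real
  assumes "0 < t" "0 \<le> W"
  shows "t powr (1 - p) * (t * W) powr p = t * W powr p"
  using assms by (simp add: powr_mult powr_diff)

text \<open>The plans glued along \<open>\<nu>\<close> exceed the optimal cost by at least the \<open>\<nu>\<close>-average of \<open>m\<close>,
  which vanishes only on the finitely many points \<open>(1 - t) x + t y\<close>. As the excess
  can be made arbitrarily small, no optimal plan towards \<open>\<nu>\<close> is needed.\<close>

lemma intermediate_finitely_supported:
  fixes q r :: "'a::euclidean_space pmf"
  assumes p: "1 < p" and t: "0 < t" "t < 1" and fin: "finite (set_pmf q)" "finite (set_pmf r)"
    and ws: "borel_pmf q \<in> wasserstein_space p" "borel_pmf r \<in> wasserstein_space p"
      "\<nu> \<in> wasserstein_space p"
    and W: "W = wasserstein p (borel_pmf q) (borel_pmf r)"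
      "wasserstein p (borel_pmf q) \<nu> = t * W" "wasserstein p \<nu> (borel_pmf r) = (1 - t) * W"
  obtains n where "\<nu> = borel_pmf n" "finite (set_pmf n)"
proof -
  define k l where "k = t powr (1 - p)" and "l = (1 - t) powr (1 - p)"
  have kl: "0 < k" "0 < l" using t by (auto simp: k_def l_def)
  have W0: "0 \<le> W" by (simp add: W(1) wasserstein_def)
  have \<nu>: "borel_prob \<nu>" using ws by (simp add: wasserstein_space_def)
  define S where "S = set_pmf q \<times> set_pmf r"
  have S: "finite S" "S \<noteq> {}" using fin by (auto simp: S_def set_pmf_not_empty)
  \<comment> \<open>Excess cost of the detour from \<open>x\<close> to \<open>y\<close> through
    \<open>z\<close>. Its minimum \<open>m\<close> over the finitely many pairs is free of
    \<open>x\<close> and \<open>y\<close>, as \<open>semidiscrete_excess\<close> requires.\<close>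
  define D where "D = (\<lambda>(z :: 'a) (x, y). k * norm (x - z) powr p + l * norm (z - y) powr p - norm (x - y) powr p)"
  have D0: "0 \<le> D z w" for z w
    using norm_diff_powr_le_split(1)[OF p t, of "fst w" "snd w" z]
    by (simp add: D_def k_def l_def split_beta)
  have Deq: "z = (1 - t) *\<^sub>R fst w + t *\<^sub>R snd w" if "D z w = 0" for z w
    using norm_diff_powr_le_split(2)[OF p t, of "fst w" "snd w" z] that
    by (simp add: D_def k_def l_def split_beta)
  define m where "m = (\<lambda>z. INF w\<in>S. ennreal (D z w))"
  have [measurable]: "m \<in> borel_measurable borel"
    unfolding m_def using S
    by (intro borel_measurable_INF) (auto simp: D_def split_beta countable_finite)
  have cost: "(\<integral>\<^sup>+w. ennreal (c * norm (fst w - snd w) powr p) \<partial>\<sigma>) = ennreal c * transport_cost p \<sigma>"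
    if "\<sigma> \<in> couplings \<rho> \<mu>" "0 \<le> c" for c and \<sigma> :: "('a \<times> 'a) measure" and \<rho> \<mu>
    unfolding transport_cost_def using that(2)
    by (simp add: ennreal_mult nn_integral_cmult measurable_couplings[OF that(1)])
  have "ennreal (W powr p) + (\<integral>\<^sup>+z. m z \<partial>\<nu>)
      \<le> ennreal k * transport_cost p \<sigma> + ennreal l * transport_cost p \<tau>"
    if \<sigma>: "\<sigma> \<in> couplings (borel_pmf q) \<nu>" and \<tau>: "\<tau> \<in> couplings \<nu> (borel_pmf r)" for \<sigma> \<tau>
  proof -
    note \<tau>' = couplings_swap[OF \<tau>]
    have "ennreal (W powr p) + (\<integral>\<^sup>+z. m z \<partial>\<nu>)
      \<le> (\<integral>\<^sup>+w. ennreal (k * norm (fst w - snd w) powr p) \<partial>\<sigma>)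
        + (\<integral>\<^sup>+w. ennreal (l * norm (fst w - snd w) powr p) \<partial>distr \<tau> borel prod.swap)"
      unfolding W(1)
    proof (rule semidiscrete_excess[OF _ fin \<nu> \<sigma> \<tau>'(1)])
      fix x y z assume xy: "x \<in> set_pmf q" "y \<in> set_pmf r"
      have "m z \<le> ennreal (D z (x, y))"
        unfolding m_def using xy by (intro INF_lower) (auto simp: S_def)
      then have "ennreal (norm (x - y) powr p) + m z \<le> ennreal (norm (x - y) powr p) + ennreal (D z (x, y))"
        by (rule add_left_mono)
      also have "\<dots> = ennreal (norm (x - y) powr p + D z (x, y))"
        using D0 by (subst ennreal_plus) auto
      also have "\<dots> = ennreal (k * norm (x - z) powr p) + ennreal (l * norm (y - z) powr p)"
        using kl by (subst ennreal_plus[symmetric]) (auto simp: D_def norm_minus_commute)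
      finally show "ennreal (norm (x - y) powr p) + m z
          \<le> ennreal (k * norm (fst (x, z) - snd (x, z)) powr p) + ennreal (l * norm (fst (y, z) - snd (y, z)) powr p)"
        by simp
    qed (use p in auto)
    then show ?thesis
      using kl by (simp add: cost[OF \<sigma>] cost[OF \<tau>'(1)] \<tau>'(2))
  qed
  then have "ennreal (W powr p) + (\<integral>\<^sup>+z. m z \<partial>\<nu>)
      \<le> ennreal k * (INF \<sigma>\<in>couplings (borel_pmf q) \<nu>. transport_cost p \<sigma>)
        + ennreal l * (INF \<tau>\<in>couplings \<nu> (borel_pmf r). transport_cost p \<tau>)"
    by (intro ennreal_le_affine_Inf kl)
  also have "\<dots> = ennreal k * ennreal ((t * W) powr p) + ennreal l * ennreal (((1 - t) * W) powr p)"
    using p ws by (simp add: ennreal_wasserstein_powr[symmetric] W(2,3))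
  also have "\<dots> = ennreal (k * (t * W) powr p + l * ((1 - t) * W) powr p)"
    using kl by (simp add: ennreal_mult)
  also have "k * (t * W) powr p + l * ((1 - t) * W) powr p = W powr p"
    using powr_one_minus_mult_powr[of t W p] powr_one_minus_mult_powr[of "1 - t" W p] t W0
    by (simp add: k_def l_def algebra_simps)
  \<comment> \<open>The term \<open>W powr p\<close> is finite and can be cancelled, which leaves a
    nonnegative integrand with integral zero.\<close>
  finally have "ennreal (W powr p) + (\<integral>\<^sup>+z. m z \<partial>\<nu>) \<le> ennreal (W powr p) + 0"
    by simp
  then have "(\<integral>\<^sup>+z. m z \<partial>\<nu>) = 0"
    by (subst (asm) ennreal_add_left_cancel_le) simp
  moreover have "m \<in> borel_measurable \<nu>"
    using \<nu> measurable_cong_sets[of \<nu> borel] by (auto simp: borel_prob_def)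
  ultimately have "AE z in \<nu>. m z = 0"
    by (simp add: nn_integral_0_iff_AE)
  moreover have "z \<in> (\<lambda>w. (1 - t) *\<^sub>R fst w + t *\<^sub>R snd w) ` S" if z: "m z = 0" for z
  proof -
    have "m z = Min ((\<lambda>w. ennreal (D z w)) ` S)"
      unfolding m_def using S by (simp add: cInf_eq_Min)
    also have "\<dots> \<in> (\<lambda>w. ennreal (D z w)) ` S"
      using S by (intro Min_in) auto
    finally obtain w where w: "w \<in> S" "ennreal (D z w) = 0"
      unfolding z by (elim imageE) simp
    then have "D z w = 0"
      using D0[of z w] by (simp add: ennreal_eq_0_iff)
    then show ?thesis
      using Deq w by blast
  qed
  ultimately have AE: "AE z in \<nu>. z \<in> (\<lambda>w. (1 - t) *\<^sub>R fst w + t *\<^sub>R snd w) ` S"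
    by (auto elim: eventually_mono)
  obtain n where n: "\<nu> = borel_pmf n" "set_pmf n \<subseteq> (\<lambda>w. (1 - t) *\<^sub>R fst w + t *\<^sub>R snd w) ` S"
    using borel_pmf_finitely_supported[OF \<nu> _ AE] S by blast
  show ?thesis
    using n S finite_subset by (intro that[of n]) blast+
qed

subsection \<open>Geodesics between finitely supported measures\<close>

lemma pmf_expectation_mono:
  fixes f g :: "'a \<Rightarrow> real"
  assumes "finite (set_pmf A)" "\<And>x. x \<in> set_pmf A \<Longrightarrow> f x \<le> g x"
  shows "measure_pmf.expectation A f \<le> measure_pmf.expectation A g"
  using assms by (intro integral_mono_AE integrable_measure_pmf_finite) (auto simp: AE_measure_pmf_iff)

text \<open>The nonnegative difference \<open>g - f\<close> has mean zero, so it vanishes almost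
  surely; for a pmf this means at every point of the support.\<close>

lemma pmf_expectation_eq_imp_eq:
  fixes f g :: "'a \<Rightarrow> real"
  assumes fin: "finite (set_pmf A)" and le: "\<And>x. x \<in> set_pmf A \<Longrightarrow> f x \<le> g x"
    and eq: "measure_pmf.expectation A g \<le> measure_pmf.expectation A f" and x: "x \<in> set_pmf A"
  shows "f x = g x"
proof -
  have int: "integrable (measure_pmf A) h" for h :: "'a \<Rightarrow> real"
    using fin by (rule integrable_measure_pmf_finite)
  have ae: "AE y in measure_pmf A. 0 \<le> g y - f y"
    using le by (simp add: AE_measure_pmf_iff)
  then have "0 \<le> measure_pmf.expectation A (\<lambda>y. g y - f y)"
    by (rule integral_nonneg_AE)
  then have "measure_pmf.expectation A (\<lambda>y. g y - f y) = 0"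
    using eq int by simp
  then have "AE y in measure_pmf A. g y - f y = 0"
    using integral_nonneg_eq_0_iff_AE[OF int ae] by simp
  then show ?thesis
    using x by (simp add: AE_measure_pmf_iff)
qed

lemma pmf_cost_map:
  "pmf_cost p (map_pmf h A) = measure_pmf.expectation A (\<lambda>x. norm (fst (h x) - snd (h x)) powr p)"
  by (simp add: pmf_cost_def)

text \<open>A pair is read as a particle with its start and end point. Taking it as one argument
  makes \<open>interp t\<close> the map that pushes a plan to its measure at time
  \<open>t\<close>.\<close>

definition interp :: "real \<Rightarrow> 'a::real_vector \<times> 'a \<Rightarrow> 'a" where
  "interp t w = (1 - t) *\<^sub>R fst w + t *\<^sub>R snd w"

lemma interp_0[simp]: "interp 0 = fst"
  and interp_1[simp]: "interp 1 = snd"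
  by (auto simp: interp_def)

text \<open>The equality case of the triangle inequality for the transport distance: every plan glued from
  optimal halves attains the optimal cost, so the pointwise convexity inequality is an equality.\<close>

lemma optimal_halves_collinear:
  fixes \<sigma> \<tau> :: "('a::euclidean_space \<times> 'a) pmf"
  assumes p: "1 < p" and t: "0 < t" "t < 1" and W: "0 \<le> W"
    and fin: "finite (set_pmf q)" "finite (set_pmf n)" "finite (set_pmf r)"
    and \<sigma>: "\<sigma> \<in> pmf_couplings q n" "pmf_cost p \<sigma> = (t * W) powr p"
    and \<tau>: "\<tau> \<in> pmf_couplings n r" "pmf_cost p \<tau> = ((1 - t) * W) powr p"
    and opt: "\<And>\<pi>. \<pi> \<in> pmf_couplings q r \<Longrightarrow> W powr p \<le> pmf_cost p \<pi>"
  obtains C where "map_pmf fst C = \<sigma>" "map_pmf snd C = \<tau>"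
    "set_pmf C = {(a, b). a \<in> set_pmf \<sigma> \<and> b \<in> set_pmf \<tau> \<and> snd a = fst b}"
    "\<And>a b. a \<in> set_pmf \<sigma> \<Longrightarrow> b \<in> set_pmf \<tau> \<Longrightarrow> snd a = fst b \<Longrightarrow> snd a = interp t (fst a, snd b)"
    "pmf_cost p (map_pmf (\<lambda>c. (fst (fst c), snd (snd c))) C) = W powr p"
proof -
  have "map_pmf snd \<sigma> = map_pmf fst \<tau>"
    using \<sigma> \<tau> by (simp add: pmf_couplings_def)
  then obtain C where C: "map_pmf fst C = \<sigma>" "map_pmf snd C = \<tau>"
    "set_pmf C = {(a, b). a \<in> set_pmf \<sigma> \<and> b \<in> set_pmf \<tau> \<and> snd a = fst b}"
    by (rule pmf_glue)
  have "set_pmf C \<subseteq> set_pmf \<sigma> \<times> set_pmf \<tau>"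
    using C(3) by auto
  then have finC: "finite (set_pmf C)"
    using finite_set_pmf_couplings[OF \<sigma>(1) fin(1,2)] finite_set_pmf_couplings[OF \<tau>(1) fin(2,3)]
    by (auto intro: finite_subset)
  note int = integrable_measure_pmf_finite[OF finC]
  define f where "f = (\<lambda>c :: ('a \<times> 'a) \<times> 'a \<times> 'a. norm (fst (fst c) - snd (snd c)) powr p)"
  define g where "g = (\<lambda>c :: ('a \<times> 'a) \<times> 'a \<times> 'a. t powr (1 - p) * norm (fst (fst c) - snd (fst c)) powr p
    + (1 - t) powr (1 - p) * norm (fst (snd c) - snd (snd c)) powr p)"
  have le: "f w \<le> g w" if "w \<in> set_pmf C" for w
    using that norm_diff_powr_le_split(1)[OF p t, of "fst (fst w)" "snd (snd w)" "snd (fst w)"]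
    by (auto simp: f_def g_def C(3))
  have "map_pmf (\<lambda>c. (fst (fst c), snd (snd c))) C \<in> pmf_couplings q r"
    using \<sigma>(1) \<tau>(1) C(1,2)
    by (auto simp: pmf_couplings_def map_pmf_comp)
  from opt[OF this] have lower: "W powr p \<le> measure_pmf.expectation C f"
    by (simp add: pmf_cost_map f_def)
  have "measure_pmf.expectation C g =
      t powr (1 - p) * pmf_cost p \<sigma> + (1 - t) powr (1 - p) * pmf_cost p \<tau>"
    unfolding C(1,2)[symmetric] pmf_cost_map g_def
    by (subst Bochner_Integration.integral_add) (auto intro: int)
  also have "\<dots> = W powr p"
    using powr_one_minus_mult_powr[of t W p] powr_one_minus_mult_powr[of "1 - t" W p] t W
    by (simp add: \<sigma> \<tau> algebra_simps)
  finally have upper: "measure_pmf.expectation C g = W powr p" .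
  have "snd a = interp t (fst a, snd b)"
    if ab: "a \<in> set_pmf \<sigma>" "b \<in> set_pmf \<tau>" "snd a = fst b" for a b
  proof -
    \<comment> \<open>The full support of the gluing matters here: every compatible pair of atoms
      occurs in \<open>C\<close>, including pairs whose halves come from different
      particles.\<close>
    have "(a, b) \<in> set_pmf C"
      using ab by (simp add: C(3))
    then have "f (a, b) = g (a, b)"
      using lower upper by (intro pmf_expectation_eq_imp_eq[OF finC] le) simp_all
    then show ?thesis
      using norm_diff_powr_le_split(2)[OF p t, of "fst a" "snd b" "snd a"] ab(3)
      by (simp add: f_def g_def interp_def)
  qed
  moreover have "pmf_cost p (map_pmf (\<lambda>c. (fst (fst c), snd (snd c))) C) = W powr p"
    using lower upper pmf_expectation_mono[where f=f and g=g, OF finC le]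
    by (simp add: pmf_cost_map f_def)
  ultimately show ?thesis
    using C that by blast
qed

lemma map_interp_couplings:
  assumes "\<alpha> \<in> pmf_couplings q r"
  shows "map_pmf (\<lambda>w. (fst w, interp t w)) \<alpha> \<in> pmf_couplings q (map_pmf (interp t) \<alpha>)"
    and "map_pmf (\<lambda>w. (interp t w, snd w)) \<alpha> \<in> pmf_couplings (map_pmf (interp t) \<alpha>) r"
  using assms by (auto simp: pmf_couplings_def map_pmf_comp)

text \<open>Displacements along a segment are proportional to elapsed time, so the two parts of an
  optimal plan have exactly the costs required by \<open>optimal_halves_collinear\<close>.\<close>

lemma pmf_cost_interp:
  fixes \<alpha> :: "('a::real_normed_vector \<times> 'a) pmf"
  assumes "0 \<le> t" "t \<le> 1" "0 \<le> W" "pmf_cost p \<alpha> = W powr p"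
  shows "pmf_cost p (map_pmf (\<lambda>w. (fst w, interp t w)) \<alpha>) = (t * W) powr p"
    and "pmf_cost p (map_pmf (\<lambda>w. (interp t w, snd w)) \<alpha>) = ((1 - t) * W) powr p"
proof -
  have "fst w - interp t w = t *\<^sub>R (fst w - snd w)"
       "interp t w - snd w = (1 - t) *\<^sub>R (fst w - snd w)" for w :: "'a \<times> 'a"
    by (simp_all add: interp_def algebra_simps)
  then show "pmf_cost p (map_pmf (\<lambda>w. (fst w, interp t w)) \<alpha>) = (t * W) powr p"
    "pmf_cost p (map_pmf (\<lambda>w. (interp t w, snd w)) \<alpha>) = ((1 - t) * W) powr p"
    using assms by (simp_all add: pmf_cost_map powr_mult pmf_cost_def)
qed

text \<open>Gluing \<open>\<kappa>\<close> with the second half of \<open>\<alpha>\<close> gives segments, on which the interior point and the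
  far endpoint determine the starting point.\<close>

lemma optimal_to_interior_unique:
  fixes \<alpha> \<kappa> :: "('a::euclidean_space \<times> 'a) pmf"
  assumes p: "1 < p" and t: "0 < t" "t < 1" and W: "0 \<le> W"
    and fin: "finite (set_pmf q)" "finite (set_pmf r)"
    and opt: "\<And>\<pi>. \<pi> \<in> pmf_couplings q r \<Longrightarrow> W powr p \<le> pmf_cost p \<pi>"
    and \<alpha>: "\<alpha> \<in> pmf_couplings q r" "pmf_cost p \<alpha> = W powr p"
    and \<kappa>: "\<kappa> \<in> pmf_couplings q (map_pmf (interp t) \<alpha>)" "pmf_cost p \<kappa> = (t * W) powr p"
  shows "\<kappa> = map_pmf (\<lambda>w. (fst w, interp t w)) \<alpha>"
    and "a \<in> set_pmf \<kappa> \<Longrightarrow> w \<in> set_pmf \<alpha> \<Longrightarrow> snd a = interp t w \<Longrightarrow> fst a = fst w"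
proof -
  have fin': "finite (set_pmf (map_pmf (interp t) \<alpha>))"
    using finite_set_pmf_couplings[OF \<alpha>(1) fin] by simp
  have t': "0 \<le> t" "t \<le> 1" using t by auto
  note \<tau> = map_interp_couplings(2)[OF \<alpha>(1), of t] pmf_cost_interp(2)[OF t' W \<alpha>(2)]
  have fst_eq: "fst a = fst w" if aw: "a \<in> set_pmf \<kappa>" "w \<in> set_pmf \<alpha>" "snd a = interp t w" for a w
  proof -
    have "snd a = interp t (fst a, snd w)"
    proof (rule optimal_halves_collinear[OF p t W fin(1) fin' fin(2) \<kappa> \<tau> opt])
      fix C
      assume "\<And>a b. a \<in> set_pmf \<kappa> \<Longrightarrow> b \<in> set_pmf (map_pmf (\<lambda>w. (interp t w, snd w)) \<alpha>) \<Longrightarrow>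
        snd a = fst b \<Longrightarrow> snd a = interp t (fst a, snd b)"
      from this[of a "(interp t w, snd w)"] show ?thesis
        using aw by auto
    qed
    then show ?thesis
      using aw(3) t by (simp add: interp_def)
  qed
  then show "a \<in> set_pmf \<kappa> \<Longrightarrow> w \<in> set_pmf \<alpha> \<Longrightarrow> snd a = interp t w \<Longrightarrow> fst a = fst w" .
  have "map_pmf snd \<kappa> = map_pmf (interp t) \<alpha>"
    using \<kappa> by (simp add: pmf_couplings_def)
  then obtain C where C: "map_pmf fst C = \<kappa>" "map_pmf snd C = \<alpha>"
    "set_pmf C = {(a, b). a \<in> set_pmf \<kappa> \<and> b \<in> set_pmf \<alpha> \<and> snd a = interp t b}"
    by (rule pmf_glue)
  \<comment> \<open>By \<open>fst_eq\<close>, in each glued pair the atom of \<open>\<kappa>\<close>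
    is a function of the atom of \<open>\<alpha>\<close>, so the second marginal of \<open>C\<close>
    determines the first.\<close>
  have "map_pmf fst C = map_pmf (\<lambda>c. (fst (snd c), interp t (snd c))) C"
    using fst_eq by (intro map_pmf_cong refl) (auto simp: C(3) prod_eq_iff)
  also have "\<dots> = map_pmf (\<lambda>w. (fst w, interp t w)) (map_pmf snd C)"
    by (simp add: map_pmf_comp)
  finally show "\<kappa> = map_pmf (\<lambda>w. (fst w, interp t w)) \<alpha>"
    by (simp add: C)
qed

text \<open>Apply \<open>optimal_to_interior_unique\<close> to the first part of
  \<open>\<alpha>\<close> itself: particles that meet at an interior time have the same start, and
  since \<open>0 < t\<close> the common position then fixes the end.\<close>

lemma inj_on_interp_optimal:
  fixes \<alpha> :: "('a::euclidean_space \<times> 'a) pmf"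
  assumes "1 < p" and t: "0 < t" "t < 1" and "0 \<le> W"
    and "finite (set_pmf q)" "finite (set_pmf r)"
    and "\<And>\<pi>. \<pi> \<in> pmf_couplings q r \<Longrightarrow> W powr p \<le> pmf_cost p \<pi>"
    and \<alpha>: "\<alpha> \<in> pmf_couplings q r" "pmf_cost p \<alpha> = W powr p"
  shows "inj_on (interp t) (set_pmf \<alpha>)"
proof (rule inj_onI)
  fix v w assume vw: "v \<in> set_pmf \<alpha>" "w \<in> set_pmf \<alpha>" "interp t v = interp t w"
  have t': "0 \<le> t" "t \<le> 1" using t by auto
  have "fst (fst v, interp t v) = fst w"
    using vw by (intro optimal_to_interior_unique(2)[OF assms
      map_interp_couplings(1)[OF \<alpha>(1), of t] pmf_cost_interp(1)[OF t' \<open>0 \<le> W\<close> \<alpha>(2)]]) auto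
  then show "v = w"
    using vw(3) t by (simp add: interp_def prod_eq_iff)
qed

text \<open>The first parts of both plans are optimal towards the same interior measure and hence
  coincide; for \<open>0 < t\<close> start and interior position determine the whole
  particle.\<close>

lemma optimal_interpolation_unique:
  fixes \<alpha> \<beta> :: "('a::euclidean_space \<times> 'a) pmf"
  assumes "1 < p" and t: "0 < t" "t < 1" and "0 \<le> W"
    and "finite (set_pmf q)" "finite (set_pmf r)"
    and "\<And>\<pi>. \<pi> \<in> pmf_couplings q r \<Longrightarrow> W powr p \<le> pmf_cost p \<pi>"
    and \<alpha>: "\<alpha> \<in> pmf_couplings q r" "pmf_cost p \<alpha> = W powr p"
    and \<beta>: "\<beta> \<in> pmf_couplings q r" "pmf_cost p \<beta> = W powr p"
    and eq: "map_pmf (interp t) \<beta> = map_pmf (interp t) \<alpha>"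
  shows "\<beta> = \<alpha>"
proof -
  have t': "0 \<le> t" "t \<le> 1" using t by auto
  have "map_pmf (\<lambda>w. (fst w, interp t w)) \<beta> = map_pmf (\<lambda>w. (fst w, interp t w)) \<alpha>"
    by (rule optimal_to_interior_unique(1)[OF assms(1-9)
      map_interp_couplings(1)[OF \<beta>(1), of t, unfolded eq] pmf_cost_interp(1)[OF t' \<open>0 \<le> W\<close> \<beta>(2)]])
  moreover have "inj (\<lambda>w :: 'a \<times> 'a. (fst w, interp t w))"
    using t by (auto simp: inj_def interp_def prod_eq_iff)
  ultimately show ?thesis
    using injD[OF pmf.inj_map] by blast
qed

text \<open>Optimal plans to and from \<open>n\<close> are composed and the intermediate point is
  forgotten; collinearity lets \<open>interp t\<close> recover it.\<close>

lemma ex_optimal_interpolation: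
  fixes q n r :: "'a::euclidean_space pmf"
  assumes p: "1 < p" and t: "0 < t" "t < 1"
    and fin: "finite (set_pmf q)" "finite (set_pmf n)" "finite (set_pmf r)"
    and W: "W = wasserstein p (borel_pmf q) (borel_pmf r)"
      "wasserstein p (borel_pmf q) (borel_pmf n) = t * W"
      "wasserstein p (borel_pmf n) (borel_pmf r) = (1 - t) * W"
  obtains \<alpha> where "\<alpha> \<in> pmf_couplings q r" "pmf_cost p \<alpha> = W powr p" "map_pmf (interp t) \<alpha> = n"
proof -
  have p0: "0 < p" using p by simp
  have W0: "0 \<le> W" by (simp add: W(1) wasserstein_def)
  obtain \<sigma> where \<sigma>: "pmf_optimal p q n \<sigma>" using ex_pmf_optimal fin by blast
  obtain \<tau> where \<tau>: "pmf_optimal p n r \<tau>" using ex_pmf_optimal fin by blast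
  have \<sigma>': "\<sigma> \<in> pmf_couplings q n" "pmf_cost p \<sigma> = (t * W) powr p"
    using \<sigma> wasserstein_powr_optimal[OF p0 \<sigma>] fin by (simp_all add: pmf_optimal_def W(2))
  have \<tau>': "\<tau> \<in> pmf_couplings n r" "pmf_cost p \<tau> = ((1 - t) * W) powr p"
    using \<tau> wasserstein_powr_optimal[OF p0 \<tau>] fin by (simp_all add: pmf_optimal_def W(3))
  have opt: "W powr p \<le> pmf_cost p \<pi>" if "\<pi> \<in> pmf_couplings q r" for \<pi>
    unfolding W(1) using p0 that fin by (intro wasserstein_powr_le) auto
  obtain C where C: "map_pmf fst C = \<sigma>" "map_pmf snd C = \<tau>"
    "set_pmf C = {(a, b). a \<in> set_pmf \<sigma> \<and> b \<in> set_pmf \<tau> \<and> snd a = fst b}"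
    "\<And>a b. a \<in> set_pmf \<sigma> \<Longrightarrow> b \<in> set_pmf \<tau> \<Longrightarrow> snd a = fst b \<Longrightarrow> snd a = interp t (fst a, snd b)"
    "pmf_cost p (map_pmf (\<lambda>c. (fst (fst c), snd (snd c))) C) = W powr p"
    by (rule optimal_halves_collinear[OF p t W0 fin \<sigma>' \<tau>' opt]) (assumption, rule that, assumption+)
  define \<alpha> where "\<alpha> = map_pmf (\<lambda>c. (fst (fst c), snd (snd c))) C"
  have "\<alpha> \<in> pmf_couplings q r"
    using \<sigma>'(1) \<tau>'(1) C(1,2)
    by (auto simp: \<alpha>_def pmf_couplings_def map_pmf_comp)
  moreover have "map_pmf (interp t) \<alpha> = n"
  proof -
    have "map_pmf (interp t) \<alpha> = map_pmf (\<lambda>c. snd (fst c)) C"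
      unfolding \<alpha>_def map_pmf_comp using C(3,4) by (intro map_pmf_cong) auto
    also have "\<dots> = map_pmf snd \<sigma>"
      by (simp add: C(1)[symmetric] map_pmf_comp)
    finally show ?thesis
      using \<sigma>' by (simp add: pmf_couplings_def)
  qed
  ultimately show ?thesis
    using that C(5) by (simp add: \<alpha>_def)
qed

text \<open>The plan \<open>a t\<close> is first chosen separately at each interior time. The fact
  \<open>mono\<close> shows that the plan chosen for a later time also interpolates the earlier
  measure, and uniqueness there identifies the two.\<close>

lemma wasserstein_geodesic_finitely_supported:
  fixes \<rho> :: "real \<Rightarrow> 'a::euclidean_space measure"
  assumes p: "1 < p" and geo: "wasserstein_geodesic p \<rho>"
    and \<rho>0: "borel_prob (\<rho> 0)" "finitely_supported (\<rho> 0)"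
    and \<rho>1: "borel_prob (\<rho> 1)" "finitely_supported (\<rho> 1)"
  obtains \<alpha> where "finite (set_pmf \<alpha>)"
    "pmf_cost p \<alpha> = wasserstein p (\<rho> 0) (\<rho> 1) powr p"
    "\<And>t. t \<in> {0..1} \<Longrightarrow> \<rho> t = borel_pmf (map_pmf (interp t) \<alpha>)"
    "\<And>t. 0 < t \<Longrightarrow> t < 1 \<Longrightarrow> inj_on (interp t) (set_pmf \<alpha>)"
proof -
  have p0: "0 < p" using p by simp
  define W where "W = wasserstein p (\<rho> 0) (\<rho> 1)"
  have W0: "0 \<le> W" by (simp add: W_def wasserstein_def)
  have ws: "\<rho> t \<in> wasserstein_space p" if "t \<in> {0..1}" for t
    using geo that by (simp add: wasserstein_geodesic_def)
  have dist: "wasserstein p (\<rho> s) (\<rho> t) = (t - s) * W" if "0 \<le> s" "s \<le> t" "t \<le> 1" for s t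
  proof -
    have "\<forall>s\<in>{0..1}. \<forall>t\<in>{0..1}. wasserstein p (\<rho> s) (\<rho> t) = \<bar>s - t\<bar> * W"
      using geo unfolding wasserstein_geodesic_def W_def by (rule conjunct2)
    from bspec[OF bspec[OF this, of s], of t] show ?thesis
      using that by simp
  qed
  obtain q where q: "\<rho> 0 = borel_pmf q" "finite (set_pmf q)"
    using \<rho>0 borel_pmf_finitely_supported[of "\<rho> 0"] finite_subset unfolding finitely_supported_def by metis
  obtain r where r: "\<rho> 1 = borel_pmf r" "finite (set_pmf r)"
    using \<rho>1 borel_pmf_finitely_supported[of "\<rho> 1"] finite_subset unfolding finitely_supported_def by metis
  have "\<exists>n. \<rho> t = borel_pmf n \<and> finite (set_pmf n)" if t: "0 < t" "t < 1" for t
  proof (rule intermediate_finitely_supported[OF p t q(2) r(2), of "\<rho> t" W])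
    show "borel_pmf q \<in> wasserstein_space p" "borel_pmf r \<in> wasserstein_space p" "\<rho> t \<in> wasserstein_space p"
      using ws[of 0] ws[of 1] ws[of t] q r t by auto
    show "W = wasserstein p (borel_pmf q) (borel_pmf r)"
      "wasserstein p (borel_pmf q) (\<rho> t) = t * W" "wasserstein p (\<rho> t) (borel_pmf r) = (1 - t) * W"
      using dist[of 0 t] dist[of t 1] t q r by (auto simp: W_def)
  qed blast
  then obtain n where n: "\<And>t. 0 < t \<Longrightarrow> t < 1 \<Longrightarrow> \<rho> t = borel_pmf (n t)"
    "\<And>t. 0 < t \<Longrightarrow> t < 1 \<Longrightarrow> finite (set_pmf (n t))"
    by metis
  have opt: "W powr p \<le> pmf_cost p \<pi>" if "\<pi> \<in> pmf_couplings q r" for \<pi>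
    unfolding W_def q(1) r(1) using p0 that q r by (intro wasserstein_powr_le) auto
  have "\<exists>\<alpha>. \<alpha> \<in> pmf_couplings q r \<and> pmf_cost p \<alpha> = W powr p \<and> map_pmf (interp t) \<alpha> = n t"
    if t: "0 < t" "t < 1" for t
  proof (rule ex_optimal_interpolation[OF p t q(2) n(2) r(2), of t W])
    show "W = wasserstein p (borel_pmf q) (borel_pmf r)"
      "wasserstein p (borel_pmf q) (borel_pmf (n t)) = t * W"
      "wasserstein p (borel_pmf (n t)) (borel_pmf r) = (1 - t) * W"
      using dist[of 0 t] dist[of t 1] t q r n by (auto simp: W_def)
  qed (use t in auto)
  then obtain a where a: "\<And>t. 0 < t \<Longrightarrow> t < 1 \<Longrightarrow> a t \<in> pmf_couplings q r"
    "\<And>t. 0 < t \<Longrightarrow> t < 1 \<Longrightarrow> pmf_cost p (a t) = W powr p"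
    "\<And>t. 0 < t \<Longrightarrow> t < 1 \<Longrightarrow> map_pmf (interp t) (a t) = n t"
    by metis
  have mono: "a s = a t" if st: "0 < s" "s < t" "t < 1" for s t
  proof -
    have t: "0 < t" "t < 1" and s: "0 < s" "s < 1" and u: "0 < s / t" "s / t < 1"
      using st by auto
    \<comment> \<open>Up to time \<open>t\<close> the curve has length \<open>t * W\<close>, and the
      measure at time \<open>s\<close> divides it in proportion \<open>s / t\<close>.\<close>
    have "\<exists>\<kappa>. \<kappa> \<in> pmf_couplings q (n t) \<and> pmf_cost p \<kappa> = (t * W) powr p \<and> map_pmf (interp (s / t)) \<kappa> = n s"
    proof (rule ex_optimal_interpolation[OF p u q(2) n(2)[OF s] n(2)[OF t], of "t * W"])
      show "t * W = wasserstein p (borel_pmf q) (borel_pmf (n t))"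
        "wasserstein p (borel_pmf q) (borel_pmf (n s)) = s / t * (t * W)"
        using dist[of 0 t] dist[of 0 s] t s q n by auto
      show "wasserstein p (borel_pmf (n s)) (borel_pmf (n t)) = (1 - s / t) * (t * W)"
      proof -
        have "(1 - s / t) * (t * W) = (t - s) * W"
          using t by (simp add: algebra_simps)
        then show ?thesis
          using dist[of s t] t s st n by (simp only: less_imp_le)
      qed
    qed blast
    then obtain \<kappa> where \<kappa>: "\<kappa> \<in> pmf_couplings q (n t)" "pmf_cost p \<kappa> = (t * W) powr p"
      "map_pmf (interp (s / t)) \<kappa> = n s" by blast
    have "\<kappa> = map_pmf (\<lambda>w. (fst w, interp t w)) (a t)"
      using \<kappa> by (intro optimal_to_interior_unique(1)[OF p t W0 q(2) r(2) opt a(1)[OF t] a(2)[OF t]])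
        (auto simp: a(3)[OF t])
    then have "n s = map_pmf (\<lambda>w. interp (s / t) (fst w, interp t w)) (a t)"
      by (simp add: \<kappa>(3)[symmetric] map_pmf_comp)
    \<comment> \<open>Covering the fraction \<open>s / t\<close> of the way to the position at time
      \<open>t\<close> leads to the position at time \<open>s\<close>; hence \<open>a t\<close>
      interpolates \<open>n s\<close> as well.\<close>
    also have "(\<lambda>w. interp (s / t) (fst w, interp t w)) = (interp s :: 'a \<times> 'a \<Rightarrow> 'a)"
      using t by (simp add: fun_eq_iff interp_def algebra_simps)
    finally show "a s = a t"
      by (intro optimal_interpolation_unique[OF p s W0 q(2) r(2) opt a(1)[OF t] a(2)[OF t] a(1)[OF s] a(2)[OF s]])
        (auto simp: a(3)[OF s])
  qed
  define \<alpha> where "\<alpha> = a (1 / 2)"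
  have a_eq: "a t = \<alpha>" if "0 < t" "t < 1" for t
  proof (cases t "1 / 2 :: real" rule: linorder_cases)
    case less
    then show ?thesis
      unfolding \<alpha>_def using that by (intro mono) simp_all
  next
    case greater
    then show ?thesis
      unfolding \<alpha>_def using that by (intro mono[symmetric]) simp_all
  qed (simp only: \<alpha>_def)
  have \<alpha>: "\<alpha> \<in> pmf_couplings q r" "pmf_cost p \<alpha> = W powr p"
    using a[of "1 / 2"] by (auto simp: \<alpha>_def)
  have "\<rho> t = borel_pmf (map_pmf (interp t) \<alpha>)" if t: "t \<in> {0..1}" for t
  proof -
    consider "t = 0" | "t = 1" | "0 < t" "t < 1"
      using t by fastforce
    then show ?thesis
      using \<alpha>(1) q(1) r(1) n(1)[of t] a(3)[of t] a_eq[of t]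
      by cases (auto simp: pmf_couplings_def)
  qed
  then show ?thesis
    using that[of \<alpha>] \<alpha> finite_set_pmf_couplings[OF \<alpha>(1) q(2) r(2)]
      inj_on_interp_optimal[OF p _ _ W0 q(2) r(2) opt \<alpha>]
    by (auto simp: W_def)
qed

subsection \<open>Constancy of the optimal coupling\<close>

text \<open>Two gluings replace first the left and then the right position by a particle located
  there. When particles share a position the lift involves a choice.\<close>

lemma lift_pmf_coupling:
  assumes "\<pi> \<in> pmf_couplings (map_pmf f \<alpha>) (map_pmf g \<beta>)"
  obtains w where "w \<in> pmf_couplings \<alpha> \<beta>" "map_pmf (map_prod f g) w = \<pi>"
proof -
  have "map_pmf f \<alpha> = map_pmf fst \<pi>"
    using assms by (simp add: pmf_couplings_def)
  then obtain C where C: "map_pmf fst C = \<alpha>" "map_pmf snd C = \<pi>"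
    "set_pmf C = {(a, b). a \<in> set_pmf \<alpha> \<and> b \<in> set_pmf \<pi> \<and> f a = fst b}"
    by (rule pmf_glue)
  have "map_pmf (\<lambda>c. snd (snd c)) C = map_pmf snd (map_pmf snd C)"
    by (simp add: map_pmf_comp)
  also have "\<dots> = map_pmf g \<beta>"
    using assms by (simp add: C(2) pmf_couplings_def)
  finally obtain D where D: "map_pmf fst D = C" "map_pmf snd D = \<beta>"
    "set_pmf D = {(a, b). a \<in> set_pmf C \<and> b \<in> set_pmf \<beta> \<and> snd (snd a) = g b}"
    by (rule pmf_glue)
  define w where "w = map_pmf (\<lambda>d. (fst (fst d), snd d)) D"
  have "map_pmf fst w = map_pmf fst (map_pmf fst D)" "map_pmf snd w = map_pmf snd D"
    by (simp_all add: w_def map_pmf_comp)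
  then have "w \<in> pmf_couplings \<alpha> \<beta>"
    by (simp add: pmf_couplings_def C D)
  moreover have "map_pmf (map_prod f g) w = map_pmf (\<lambda>d. snd (fst d)) D"
    unfolding w_def map_pmf_comp by (intro map_pmf_cong refl) (auto simp: D(3) C(3) prod_eq_iff)
  then have "map_pmf (map_prod f g) w = map_pmf snd (map_pmf fst D)"
    by (simp add: map_pmf_comp)
  ultimately show ?thesis
    using that by (simp add: C D)
qed

lemma map_prod_pmf_couplings:
  assumes "w \<in> pmf_couplings \<alpha> \<beta>"
  shows "map_pmf (map_prod f g) w \<in> pmf_couplings (map_pmf f \<alpha>) (map_pmf g \<beta>)"
  using assms by (auto simp: pmf_couplings_def map_pmf_comp)

text \<open>Since every plan between the images lifts, the problem at each time becomes one over the
  fixed set \<open>pmf_couplings \<alpha> \<beta>\<close>, with time only in the cost. This includes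
  \<open>fst\<close> and \<open>snd\<close>, under which particles may merge.\<close>

lemma pmf_optimal_map_prod_iff:
  assumes "w \<in> pmf_couplings \<alpha> \<beta>"
  shows "pmf_optimal p (map_pmf f \<alpha>) (map_pmf g \<beta>) (map_pmf (map_prod f g) w) \<longleftrightarrow>
    (\<forall>v\<in>pmf_couplings \<alpha> \<beta>. pmf_cost p (map_pmf (map_prod f g) w) \<le> pmf_cost p (map_pmf (map_prod f g) v))"
    (is "?L \<longleftrightarrow> ?R")
proof
  show "?L \<Longrightarrow> ?R"
    unfolding pmf_optimal_def using map_prod_pmf_couplings by blast
  assume ?R
  show ?L
    unfolding pmf_optimal_def
  proof (intro conjI ballI map_prod_pmf_couplings assms)
    fix \<pi> assume "\<pi> \<in> pmf_couplings (map_pmf f \<alpha>) (map_pmf g \<beta>)"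
    then obtain v where "v \<in> pmf_couplings \<alpha> \<beta>" "map_pmf (map_prod f g) v = \<pi>"
      by (rule lift_pmf_coupling)
    then show "pmf_cost p (map_pmf (map_prod f g) w) \<le> pmf_cost p \<pi>"
      using \<open>?R\<close> by blast
  qed
qed

text \<open>If \<open>v\<close> has support inside that of \<open>w\<close>, the segment from \<open>v\<close> to \<open>w\<close> can be prolonged beyond
  \<open>w\<close>; a linear functional minimal at \<open>w\<close> is then constant on it.\<close>

lemma unique_minimiser_determined_by_support:
  fixes k :: "'a \<times> 'b \<Rightarrow> real"
  assumes fin: "finite (set_pmf \<alpha>)" "finite (set_pmf \<beta>)"
    and w: "w \<in> pmf_couplings \<alpha> \<beta>" and v: "v \<in> pmf_couplings \<alpha> \<beta>" "set_pmf v \<subseteq> set_pmf w"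
    and min: "\<And>u. u \<in> pmf_couplings \<alpha> \<beta> \<Longrightarrow> measure_pmf.expectation w k \<le> measure_pmf.expectation u k"
    and uniq: "\<And>u. u \<in> pmf_couplings \<alpha> \<beta> \<Longrightarrow>
      measure_pmf.expectation u k \<le> measure_pmf.expectation w k \<Longrightarrow> u = w"
  shows "v = w"
proof -
  define S where "S = set_pmf w"
  \<comment> \<open>The step beyond \<open>w\<close>: as \<open>v\<close> has weights at most 1,
    subtracting \<open>\<delta> * pmf v z\<close> cannot exceed the smallest positive weight of
    \<open>w\<close>.\<close>
  define \<delta> where "\<delta> = Min (pmf w ` S)"
  have S: "finite S" "S \<noteq> {}"
    using finite_set_pmf_couplings[OF w fin] by (auto simp: S_def set_pmf_not_empty)
  have "\<delta> \<in> pmf w ` S"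
    unfolding \<delta>_def using S by (intro Min_in) auto
  then have \<delta>: "0 < \<delta>"
    by (auto simp: S_def pmf_positive)
  define f where "f = (\<lambda>z. pmf w z + \<delta> * (pmf w z - pmf v z))"
  have sum1: "(\<Sum>z\<in>S. pmf w z) = 1" "(\<Sum>z\<in>S. pmf v z) = 1"
    using S v by (auto intro!: sum_pmf_eq_1 simp: S_def)
  have "0 \<le> f z" if "z \<in> S" for z
  proof -
    have "\<delta> \<le> pmf w z"
      unfolding \<delta>_def using S that by (intro Min_le) auto
    moreover have "\<delta> * pmf v z \<le> \<delta>" "0 \<le> \<delta> * pmf w z"
      using \<delta> by (simp_all add: mult_left_le pmf_le_1)
    ultimately show ?thesis
      by (simp add: f_def right_diff_distrib)
  qed
  moreover have "sum f S = 1"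
    by (simp add: f_def sum.distrib sum_subtractf sum_distrib_left[symmetric] sum1)
  ultimately obtain u where u: "\<And>z. pmf u z = (if z \<in> S then f z else 0)" "set_pmf u \<subseteq> S"
    using obtain_pmf_of_weights[OF S(1), of f] by blast
  have uf: "pmf u z = f z" for z
  proof (cases "z \<in> S")
    case False
    then have "pmf w z = 0" "pmf v z = 0"
      using v(2) by (auto simp: S_def set_pmf_iff)
    then show ?thesis
      using False by (simp add: u f_def)
  qed (simp add: u)
  have sub: "set_pmf w \<subseteq> set_pmf \<alpha> \<times> set_pmf \<beta>"
    using w by (rule set_pmf_couplings)
  have "u \<in> pmf_couplings \<alpha> \<beta>"
    using pmf_couplings_iff[OF fin, of u] pmf_couplings_iff[OF fin, of w] pmf_couplings_iff[OF fin, of v]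
      w v u(2) sub
    by (simp add: S_def uf f_def sum.distrib sum_subtractf sum_distrib_left[symmetric])
  moreover have E: "measure_pmf.expectation x k = (\<Sum>z\<in>S. k z * pmf x z)" if "set_pmf x \<subseteq> S" for x
    using S that by (intro integral_measure_pmf_real) auto
  then have "measure_pmf.expectation u k = measure_pmf.expectation w k
      + \<delta> * (measure_pmf.expectation w k - measure_pmf.expectation v k)"
    using u(2) v(2)
    by (simp add: S_def uf f_def algebra_simps sum.distrib sum_subtractf sum_distrib_left)
  \<comment> \<open>Minimality of \<open>w\<close> against the prolonged point \<open>u\<close>
    bounds the cost of \<open>v\<close> by that of \<open>w\<close>, so \<open>uniq\<close> applies
    to \<open>v\<close>.\<close>
  ultimately have "0 \<le> \<delta> * (measure_pmf.expectation w k - measure_pmf.expectation v k)"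
    using min[of u] by simp
  then have "measure_pmf.expectation v k \<le> measure_pmf.expectation w k"
    using \<delta> by (simp add: zero_le_mult_iff)
  then show ?thesis
    using uniq v(1) by blast
qed

text \<open>The times at which a given candidate is minimal form a closed set. Finitely many of
  these sets cover the interval, and uniqueness makes them disjoint.\<close>

lemma unique_minimiser_constant:
  fixes c :: "real \<Rightarrow> 'b \<Rightarrow> real"
  assumes I: "connected I"
    and cont: "\<And>w. w \<in> P \<Longrightarrow> continuous_on UNIV (\<lambda>t. c t w)"
    and m: "\<And>t. t \<in> I \<Longrightarrow> m t \<in> P" "\<And>t w. t \<in> I \<Longrightarrow> w \<in> P \<Longrightarrow> c t (m t) \<le> c t w"
    and uniq: "\<And>t w. t \<in> I \<Longrightarrow> w \<in> P \<Longrightarrow> c t w \<le> c t (m t) \<Longrightarrow> w = m t"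
    and fin: "finite (m ` I)" and st: "s \<in> I" "t \<in> I"
  shows "m s = m t"
proof -
  define F where "F = (\<lambda>w. \<Inter>v\<in>P. {t. c t w \<le> c t v})"
  have closed: "closed (F w)" if "w \<in> P" for w
    unfolding F_def using cont that by (intro closed_INT ballI closed_Collect_le) auto
  have in_F: "r \<in> F (m r)" if "r \<in> I" for r
    using m(2) that by (simp add: F_def)
  have F_eq: "w = m r" if "r \<in> I" "w \<in> P" "r \<in> F w" for r w
    using uniq[OF that(1,2)] m(1)[OF that(1)] that(3) by (simp add: F_def)
  define B where "B = (\<Union>w\<in>m ` I - {m s}. F w)"
  have "closed B"
    unfolding B_def using fin m(1) closed by (intro closed_UN) auto
  moreover have "F (m s) \<inter> B \<inter> I = {}"
  proof -
    have "m r' = m s" if "r \<in> I" "r \<in> F (m s)" "r \<in> F (m r')" "r' \<in> I" for r r'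
      using F_eq[of r "m s"] F_eq[of r "m r'"] m(1)[of s] m(1)[of r'] that st by simp
    then show ?thesis
      by (auto simp: B_def)
  qed
  moreover have "I \<subseteq> F (m s) \<union> B"
  proof
    fix r assume "r \<in> I"
    then show "r \<in> F (m s) \<union> B"
      using in_F[of r] by (cases "m r = m s") (auto simp: B_def)
  qed
  ultimately have "F (m s) \<inter> I = {} \<or> B \<inter> I = {}"
    using connected_closedD[OF I] closed[OF m(1)[OF st(1)]] by blast
  then have "t \<notin> B"
    using in_F st by blast
  then show ?thesis
    using in_F[OF st(2)] st by (cases "m t = m s") (auto simp: B_def)
qed

lemma optimal_coupling_constant:
  fixes \<alpha> \<beta> :: "('a::euclidean_space \<times> 'a) pmf"
  assumes p: "0 < p" and fin: "finite (set_pmf \<alpha>)" "finite (set_pmf \<beta>)"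
    and inj: "\<And>t. 0 < t \<Longrightarrow> t < 1 \<Longrightarrow> inj_on (interp t) (set_pmf \<alpha>)"
      "\<And>t. 0 < t \<Longrightarrow> t < 1 \<Longrightarrow> inj_on (interp t) (set_pmf \<beta>)"
    and ex1: "\<And>t. 0 < t \<Longrightarrow> t < 1 \<Longrightarrow>
      \<exists>!\<pi>. pmf_optimal p (map_pmf (interp t) \<alpha>) (map_pmf (interp t) \<beta>) \<pi>"
  obtains w where "w \<in> pmf_couplings \<alpha> \<beta>"
    "\<And>t. t \<in> {0..1} \<Longrightarrow> pmf_optimal p (map_pmf (interp t) \<alpha>) (map_pmf (interp t) \<beta>)
      (map_pmf (map_prod (interp t) (interp t)) w)"
proof -
  define E :: "real \<Rightarrow> _" where
    "E = (\<lambda>t. map_prod (interp t) (interp t) :: ('a \<times> 'a) \<times> ('a \<times> 'a) \<Rightarrow> 'a \<times> 'a)"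
  define k where "k = (\<lambda>t z. norm (fst (E t z) - snd (E t z)) powr p)"
  define c where "c = (\<lambda>t w. measure_pmf.expectation w (k t))"
  define P where "P = pmf_couplings \<alpha> \<beta>"
  have cost: "pmf_cost p (map_pmf (E t) w) = c t w" for t w
    by (simp add: c_def k_def pmf_cost_map)
  have sub: "set_pmf w \<subseteq> set_pmf \<alpha> \<times> set_pmf \<beta>" if "w \<in> P" for w
    using that unfolding P_def by (rule set_pmf_couplings)
  have opt_iff: "pmf_optimal p (map_pmf (interp t) \<alpha>) (map_pmf (interp t) \<beta>) (map_pmf (E t) w) \<longleftrightarrow>
      (\<forall>v\<in>P. c t w \<le> c t v)" if "w \<in> P" for t w
  proof -
    have "map_prod (interp t) (interp t) = E t"
      by (simp add: E_def)
    with pmf_optimal_map_prod_iff[of w \<alpha> \<beta> p "interp t" "interp t"] that show ?thesis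
      unfolding P_def by (simp only: cost)
  qed
  have "\<exists>w. w \<in> P \<and> (\<forall>v\<in>P. c t w \<le> c t v) \<and> (\<forall>v\<in>P. c t v \<le> c t w \<longrightarrow> v = w)"
    if t: "0 < t" "t < 1" for t
  proof -
    obtain \<pi> where \<pi>: "pmf_optimal p (map_pmf (interp t) \<alpha>) (map_pmf (interp t) \<beta>) \<pi>"
      using ex1[OF t] by blast
    then have "\<pi> \<in> pmf_couplings (map_pmf (interp t) \<alpha>) (map_pmf (interp t) \<beta>)"
      by (simp add: pmf_optimal_def)
    then obtain w where w: "w \<in> P" "map_pmf (E t) w = \<pi>"
      unfolding P_def E_def by (rule lift_pmf_coupling)
    have w_min: "\<forall>v\<in>P. c t w \<le> c t v"
      using \<pi> unfolding w(2)[symmetric] by (rule opt_iff[OF w(1), THEN iffD1])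
    \<comment> \<open>This turns uniqueness of the plan at time \<open>t\<close> into uniqueness of
      the coupling of particles.\<close>
    have inj_E: "inj_on (E t) (set_pmf \<alpha> \<times> set_pmf \<beta>)"
      unfolding E_def using inj[OF t] by (rule map_prod_inj_on)
    have "v = w" if v: "v \<in> P" "c t v \<le> c t w" for v
    proof -
      have "\<forall>u\<in>P. c t v \<le> c t u"
        using v(2) w_min by (auto intro: order_trans)
      then have "pmf_optimal p (map_pmf (interp t) \<alpha>) (map_pmf (interp t) \<beta>) (map_pmf (E t) v)"
        by (rule opt_iff[OF v(1), THEN iffD2])
      then have "map_pmf (E t) v = map_pmf (E t) w"
        using \<pi> ex1[OF t] unfolding w(2) by blast
      then show ?thesis
        by (rule map_pmf_inj_on_eq[OF inj_E sub[OF v(1)] sub[OF w(1)]])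
    qed
    then show ?thesis
      using w(1) w_min by blast
  qed
  then obtain m where m: "\<And>t. 0 < t \<Longrightarrow> t < 1 \<Longrightarrow> m t \<in> P"
    "\<And>t v. 0 < t \<Longrightarrow> t < 1 \<Longrightarrow> v \<in> P \<Longrightarrow> c t (m t) \<le> c t v"
    "\<And>t v. 0 < t \<Longrightarrow> t < 1 \<Longrightarrow> v \<in> P \<Longrightarrow> c t v \<le> c t (m t) \<Longrightarrow> v = m t"
    by metis
  have cont: "continuous_on UNIV (\<lambda>t. c t w)" if "w \<in> P" for w
  proof -
    have "c t w = (\<Sum>z\<in>set_pmf \<alpha> \<times> set_pmf \<beta>. k t z * pmf w z)" for t
      unfolding c_def using fin sub[OF that] by (intro integral_measure_pmf_real) auto
    \<comment> \<open>Positivity of \<open>p\<close> gives continuity also at times when the two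
      particles coincide and the base of the power vanishes.\<close>
    moreover have "continuous_on UNIV (\<lambda>t. k t z)" for z
      unfolding k_def E_def interp_def fst_map_prod snd_map_prod using p
      by (intro continuous_on_powr' continuous_intros) auto
    ultimately show ?thesis
      by (simp only:) (intro continuous_on_sum continuous_on_mult_right)
  qed
  have "m s = m t" if st: "0 < s" "s < 1" "0 < t" "t < 1" "set_pmf (m s) = set_pmf (m t)" for s t
    using st m unfolding c_def P_def
    by (intro unique_minimiser_determined_by_support[OF fin, of "m t" "m s" "k t"]) auto
  \<comment> \<open>Minimisers are told apart by their supports, which are subsets of one finite
    set; hence only finitely many occur.\<close>
  then have "inj_on set_pmf (m ` {0<..<1})"
    by (auto simp: inj_on_def)
  moreover have "set_pmf ` m ` {0<..<1} \<subseteq> Pow (set_pmf \<alpha> \<times> set_pmf \<beta>)"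
    using sub m(1) by fastforce
  then have "finite (set_pmf ` m ` {0<..<1})"
    using fin by (auto intro: finite_subset)
  ultimately have fin_m: "finite (m ` {0<..<1})"
    by (rule finite_imageD[rotated])
  define w where "w = m (1 / 2)"
  have w: "w \<in> P"
    using m(1) by (simp add: w_def)
  have m_eq: "m t = w" if "0 < t" "t < 1" for t
    unfolding w_def using that m fin_m
    by (intro unique_minimiser_constant[where I="{0<..<1}" and P=P and c=c and m=m, OF _ cont]) auto
  have "\<forall>v\<in>P. c t w \<le> c t v" if t: "t \<in> {0..1}" for t
  proof
    fix v assume v: "v \<in> P"
    \<comment> \<open>Each comparison is a closed condition on \<open>t\<close>, so it extends from
      the open interval to its closure. Optimality of \<open>w\<close> thus reaches the endpoints,
      without any claim that \<open>w\<close> is the only minimiser there.\<close>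
    have "closed {t. c t w \<le> c t v}"
      using cont w v by (intro closed_Collect_le) auto
    moreover have "{0<..<1} \<subseteq> {t. c t w \<le> c t v}"
      using m(2) m_eq v by fastforce
    ultimately have "closure {0<..<1} \<subseteq> {t. c t w \<le> c t v}"
      by (rule closure_minimal[rotated])
    then show "c t w \<le> c t v"
      using t by auto
  qed
  then show ?thesis
    using w opt_iff[OF w] that by (simp add: P_def E_def)
qed

text \<open>The map regroups a pair of particles by time: ((x0, x1), (y0, y1)) becomes ((x0, y0),
  (x1, y1)), a coupling of the two endpoint plans. The displacement in the product space is (x0 -
  x1, y0 - y1), to which \<open>norm_Pair_powr_le\<close> applies pointwise.\<close>

lemma pmf_cost_endpoint_plans_le:
  fixes w :: "(('a::euclidean_space \<times> 'a) \<times> ('a \<times> 'a)) pmf"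
  assumes p: "1 < p" and fin: "finite (set_pmf w)"
  shows "pmf_cost p (map_pmf (\<lambda>z. (map_prod fst fst z, map_prod snd snd z)) w)
    \<le> max 1 (2 powr (p / 2 - 1)) * (pmf_cost p (map_pmf fst w) + pmf_cost p (map_pmf snd w))"
    (is "pmf_cost p (map_pmf ?h w) \<le> ?C * _")
proof -
  let ?f = "\<lambda>z :: ('a \<times> 'a) \<times> ('a \<times> 'a). norm (fst (fst z) - snd (fst z)) powr p"
  let ?g = "\<lambda>z :: ('a \<times> 'a) \<times> ('a \<times> 'a). norm (fst (snd z) - snd (snd z)) powr p"
  have "pmf_cost p (map_pmf ?h w) \<le> measure_pmf.expectation w (\<lambda>z. ?C * (?f z + ?g z))"
    unfolding pmf_cost_map
  proof (rule pmf_expectation_mono[OF fin])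
    fix z :: "('a \<times> 'a) \<times> ('a \<times> 'a)"
    have "fst (?h z) - snd (?h z) = (fst (fst z) - snd (fst z), fst (snd z) - snd (snd z))"
      by (simp add: prod_eq_iff)
    then show "norm (fst (?h z) - snd (?h z)) powr p \<le> ?C * (?f z + ?g z)"
      using norm_Pair_powr_le[OF p] by metis
  qed
  also have "\<dots> = ?C * (measure_pmf.expectation w ?f + measure_pmf.expectation w ?g)"
    by (subst integral_mult_right_zero)
      (simp add: Bochner_Integration.integral_add integrable_measure_pmf_finite[OF fin])
  finally show ?thesis
    by (simp add: pmf_cost_map)
qed

theorem theorem4p11:
  fixes p :: real
    and \<rho> \<mu> :: "real \<Rightarrow> (real ^ 'd) measure"
    and \<gamma>\<^sub>0 \<gamma>\<^sub>1 :: "((real ^ 'd) \<times> (real ^ 'd)) measure"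
  assumes "1 < p"
    and "borel_prob (\<rho> 0)" and "finitely_supported (\<rho> 0)"
    and "borel_prob (\<rho> 1)" and "finitely_supported (\<rho> 1)"
    and "borel_prob (\<mu> 0)" and "finitely_supported (\<mu> 0)"
    and "borel_prob (\<mu> 1)" and "finitely_supported (\<mu> 1)"
    and "optimal_plan p (\<rho> 0) (\<mu> 0) \<gamma>\<^sub>0"
    and "optimal_plan p (\<rho> 1) (\<mu> 1) \<gamma>\<^sub>1"
    and "wasserstein_geodesic p \<rho>"
    and "wasserstein_geodesic p \<mu>"
    and "\<And>t. t \<in> {0..1} \<Longrightarrow> \<exists>!\<gamma>. optimal_plan p (\<rho> t) (\<mu> t) \<gamma>"
  shows "wasserstein p \<gamma>\<^sub>0 \<gamma>\<^sub>1 powr p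
    \<le> max 1 (2 powr (p / 2 - 1)) *
        (wasserstein p (\<rho> 0) (\<rho> 1) powr p + wasserstein p (\<mu> 0) (\<mu> 1) powr p)"
proof -
  have p: "0 < p" using assms(1) by simp
  obtain \<alpha> where \<alpha>: "finite (set_pmf \<alpha>)"
    "pmf_cost p \<alpha> = wasserstein p (\<rho> 0) (\<rho> 1) powr p"
    "\<And>t. t \<in> {0..1} \<Longrightarrow> \<rho> t = borel_pmf (map_pmf (interp t) \<alpha>)"
    "\<And>t. 0 < t \<Longrightarrow> t < 1 \<Longrightarrow> inj_on (interp t) (set_pmf \<alpha>)"
    using wasserstein_geodesic_finitely_supported[OF assms(1,12,2-5)] by blast
  obtain \<beta> where \<beta>: "finite (set_pmf \<beta>)"
    "pmf_cost p \<beta> = wasserstein p (\<mu> 0) (\<mu> 1) powr p"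
    "\<And>t. t \<in> {0..1} \<Longrightarrow> \<mu> t = borel_pmf (map_pmf (interp t) \<beta>)"
    "\<And>t. 0 < t \<Longrightarrow> t < 1 \<Longrightarrow> inj_on (interp t) (set_pmf \<beta>)"
    using wasserstein_geodesic_finitely_supported[OF assms(1,13,6-9)] by blast
  have plan: "optimal_plan p (\<rho> t) (\<mu> t) \<gamma> \<longleftrightarrow>
      (\<exists>\<pi>. \<gamma> = borel_pmf \<pi> \<and> pmf_optimal p (map_pmf (interp t) \<alpha>) (map_pmf (interp t) \<beta>) \<pi>)"
    if "t \<in> {0..1}" for t \<gamma>
    unfolding \<alpha>(3)[OF that] \<beta>(3)[OF that]
    using \<alpha>(1) \<beta>(1) by (intro optimal_plan_borel_pmf) simp_all
  have ex1: "\<exists>!\<pi>. pmf_optimal p (map_pmf (interp t) \<alpha>) (map_pmf (interp t) \<beta>) \<pi>"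
    if "0 < t" "t < 1" for t
  proof -
    have t: "t \<in> {0..1}" using that by simp
    then show ?thesis
      using assms(14)[OF t] unfolding plan[OF t] by (metis borel_pmf_eq_iff)
  qed
  obtain w where w: "w \<in> pmf_couplings \<alpha> \<beta>"
    "\<And>t. t \<in> {0..1} \<Longrightarrow> pmf_optimal p (map_pmf (interp t) \<alpha>) (map_pmf (interp t) \<beta>)
      (map_pmf (map_prod (interp t) (interp t)) w)"
    by (rule optimal_coupling_constant[OF p \<alpha>(1) \<beta>(1) \<alpha>(4) \<beta>(4) ex1])
      (assumption+, rule that, assumption+)
  have fin: "finite (set_pmf w)"
    using finite_set_pmf_couplings[OF w(1) \<alpha>(1) \<beta>(1)] .
  have ends: "\<gamma> = borel_pmf (map_pmf (map_prod (interp t) (interp t)) w)"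
    if "optimal_plan p (\<rho> t) (\<mu> t) \<gamma>" "t \<in> {0..1}" for t \<gamma>
    using that assms(14)[OF that(2)] w(2)[OF that(2)] plan[OF that(2)] by blast
  have \<gamma>: "\<gamma>\<^sub>0 = borel_pmf (map_pmf (map_prod fst fst) w)" "\<gamma>\<^sub>1 = borel_pmf (map_pmf (map_prod snd snd) w)"
    using ends[OF assms(10)] ends[OF assms(11)] by simp_all
  have "map_pmf (\<lambda>z. (map_prod fst fst z, map_prod snd snd z)) w
      \<in> pmf_couplings (map_pmf (map_prod fst fst) w) (map_pmf (map_prod snd snd) w)"
    by (simp add: pmf_couplings_def map_pmf_comp)
  then have "wasserstein p \<gamma>\<^sub>0 \<gamma>\<^sub>1 powr p
      \<le> pmf_cost p (map_pmf (\<lambda>z. (map_prod fst fst z, map_prod snd snd z)) w)"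
    unfolding \<gamma> using p fin by (intro wasserstein_powr_le) auto
  also have "\<dots> \<le> max 1 (2 powr (p / 2 - 1)) * (pmf_cost p (map_pmf fst w) + pmf_cost p (map_pmf snd w))"
    using assms(1) fin by (rule pmf_cost_endpoint_plans_le)
  \<comment> \<open>The marginals of \<open>w\<close> are \<open>\<alpha>\<close> and
    \<open>\<beta>\<close>, whose costs are the \<open>p\<close>-th powers of the lengths of the two
    geodesics.\<close>
  finally show ?thesis
    using w(1) \<alpha>(2) \<beta>(2) by (simp add: pmf_couplings_def)
qed

end
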